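(* Let $r\geq 2$ be an integer, let $m,\ell\in\mathbb{R}$ with $4m\neq \ell^2$ and $m\neq 0$, and assume that $\zeta$ is a positive root of the polynomial \[ \begin{aligned} P_4(\zeta)=\;&8 \zeta^4+16 \ell \cos\alpha_o\, \zeta^3\\ &+\left[\cos (2 \alpha_o ) \left(16 m (r-1)-3 \ell^2 (r-2)\right)-16 m (r-1)+\ell^2 (3 r+4)\right]\zeta^2\\ &+2 \ell \cos\alpha_o \left[\ell^2-2r (4 m - \ell^2) \sin^2\alpha_o\right]\zeta-2 \ell^2\left(4m-\ell^2\right)\sin^2\alpha_o , \end{aligned} \] where $\alpha_o\in(0,\pi)$. Then: (i) any $3$-Frenet helix with $N_3=0$ of Type I, II or III (with these constants $\alpha_o,\zeta$) is proper $r$-harmonic in $M^3_{m,\ell}$; (ii) conversely, any proper $r$-harmonic $3$-Frenet helix in $M_{m,\ell}^3$ is of this form.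
   Context: For $m,\ell\in\mathbb{R}$ the Bianchi-Cartan-Vranceanu (BCV) space is \[ M^3_{m,\ell}=\Big(\bar M\times\mathbb{R},\ g=\frac{dx^2+dy^2}{F^2}+\Big[dz+\frac{\ell}{2}\,\frac{y\,dx-x\,dy}{F}\Big]^2\Big),\quad F=1+m(x^2+y^2),\quad \bar M=\{(x,y)\in\mathbb{R}^2: F>0\}, \] oriented by the orthonormal frame $E_1=F\partial_x-\frac{\ell y}{2}\partial_z$, $E_2=F\partial_y+\frac{\ell x}{2}\partial_z$, $E_3=\partial_z$. Let $\nabla$ be the Levi-Civita connection and $R(X,Y)Z=\nabla_X\nabla_YZ-\nabla_Y\nabla_XZ-\nabla_{[X,Y]}Z$. Curves are smooth and parametrized by arc length $s$ on an interval, with $T=\gamma'$, $\nabla^0_TT=T$, $\nabla_T^kT=\nabla_T(\nabla_T^{k-1}T)$. For an integer $r\ge 2$, $\gamma$ is $r$-harmonic if \[ \tau_r(\gamma)=\nabla^{2r-1}_T T+ \sum_{j=0}^{r-2}(-1)^j R\left (\nabla^{2r-3-j}_T T ,\nabla^{j}_T T\right )T=0, \] and proper $r$-harmonic if it is $r$-harmonic and not a geodesic. A $3$-Frenet helix in $M^3_{m,\ell}$ is such a curve admitting a positively oriented orthonormal field $\{T,N,B\}$ (with $B=T\wedge N$) and constants $\kappa>0$, $\tau\in\mathbb{R}$ with $\nabla_TT=\kappa N$, $\nabla_TN=-\kappa T+\tau B$, $\nabla_TB=-\tau N$. Write $N_3=\langle N,E_3\rangle$. For a non-geodesic arc-length parametrized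 curve $\gamma=(x,y,z)$ in $M^3_{m,\ell}$ ($4m\ne\ell^2$) with $N_3=0$ there are a constant $\alpha_o\in(0,\pi)$ and a smooth function $\beta(s)$ (unique up to an additive constant $2k\pi$) such that one can assume $T=\sin\alpha_o\cos\beta\,E_1+\sin\alpha_o\sin\beta\,E_2+\cos\alpha_o\,E_3$, $N=-\sin\beta\,E_1+\cos\beta\,E_2$, $B=T\wedge N$; moreover $\kappa=\zeta\sin\alpha_o$ and $\tau=\zeta\cos\alpha_o+\frac{\ell}{2}$, where $\zeta=|\beta'+2m\sin\alpha_o[y\cos\beta-x\sin\beta]-\ell\cos\alpha_o|>0$, which is constant if $\gamma$ is a $3$-Frenet helix. For $m\neq0$, the three types of parametrization of arc-length parametrized $3$-Frenet helices with $N_3=0$ are as follows. Type I: $x(s)=\mu\sin\alpha_o\sin\beta(s)+c_1$, $y(s)=-\mu\sin\alpha_o\cos\beta(s)+c_2$, $z(s)=\frac{\ell}{4m}\beta(s)+\frac{1}{4m}\left([4m-\ell^2]\cos\alpha_o-\ell\zeta\right)s$, where $\mu>0$ and $c_1,c_2$ are constants satisfying $c_1^2+c_2^2=\frac{\mu}{m}\left(\left[\ell\cos\alpha_o+\zeta-\frac{1}{\mu}\right]+m\mu\sin^2\alpha_o\right)$, and $\beta(s)$ is a nonconstant solution of $\beta'=c_1 \sin\beta-c_2 \cos\beta+2m\mu\sin^2\alpha_o+\zeta+\ell \cos\alpha_o$. Type II: $\beta(s)=\beta_o$ is a constant with $\sin\beta_o\cos\beta_o\neq0$, and $y(s)=x(s)\tan\beta_o+c_1$,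 $z(s)=\frac{1}{4m}\left([4m-\ell^2]\cos\alpha_o-\ell\zeta\right)s+c_2$, where $c_2\in\mathbb{R}$, $c_1=\frac{\zeta+\ell \cos\alpha_o}{2m\sin\alpha_o\cos\beta_o}$, and $x(s)$ is a solution of $x'(s)=\left(1+m\left[x^2(s)+(x(s)\tan\beta_o+c_1)^2\right]\right)\sin\alpha_o\cos\beta_o$. Type III: $\beta(s)=\beta_o$ is a constant with $\sin\beta_o\cos\beta_o=0$. For $\beta_o=\pi/2$: $x(s)=x_o=-\frac{\zeta+\ell\cos\alpha_o}{2m\sin\alpha_o}$, $z(s)=\frac{1}{4m}\left([4m-\ell^2]\cos\alpha_o-\ell\zeta\right)s+c_1$ with $c_1\in\mathbb{R}$ constant, and $y(s)$ is a solution of $(y'(s))^2=\left(1+m\left[x_o^2+y^2(s)\right]\right)^2\sin^2\alpha_o$; the case $\beta_o=0$ is similar up to interchanging the roles of $x$ and $y$.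
   Formalization: Type I is corrected, as (ii) fails as printed: the term c_1 sin β − c_2 cos β in the β' equation gets the factor 2m sin α_o, μ>0 becomes μ≠0, and z(s) gets an additive constant. In (ii) the helix is of this form possibly after reversing its direction s→−s. *)

theory Defs
  imports "HOL-Analysis.Analysis" "HOL-Computational_Algebra.Polynomial"
begin

section \<open>Riemannian geometry in one global chart\<close>

text \<open>A metric on an open subset of \<open>real ^ 'n\<close> is a function \<open>g\<close> with \<open>g p u v\<close> the inner product
  of the tangent vectors \<open>u\<close>, \<open>v\<close> at \<open>p\<close>; vectors are given by their coordinate components.\<close>

definition metric_matrix :: "(real^'n \<Rightarrow> real^'n \<Rightarrow> real^'n \<Rightarrow> real) \<Rightarrow> real^'n \<Rightarrow> real^'n^'n" where
  "metric_matrix g p = (\<chi> i j. g p (axis i 1) (axis j 1))"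

definition partial_deriv :: "'n \<Rightarrow> (real^'n \<Rightarrow> real) \<Rightarrow> real^'n \<Rightarrow> real" where
  "partial_deriv i f p = frechet_derivative f (at p) (axis i 1)"

definition christoffel_symbol ::
    "(real^'n \<Rightarrow> real^'n \<Rightarrow> real^'n \<Rightarrow> real) \<Rightarrow> real^'n \<Rightarrow> 'n \<Rightarrow> 'n \<Rightarrow> 'n \<Rightarrow> real" where
  "christoffel_symbol g p k i j =
     (1/2) * (\<Sum>h\<in>UNIV. matrix_inv (metric_matrix g p) $ k $ h *
        (partial_deriv i (\<lambda>q. metric_matrix g q $ j $ h) p
         + partial_deriv j (\<lambda>q. metric_matrix g q $ i $ h) p
         - partial_deriv h (\<lambda>q. metric_matrix g q $ i $ j) p))"

definition christoffel ::
    "(real^'n \<Rightarrow> real^'n \<Rightarrow> real^'n \<Rightarrow> real) \<Rightarrow> real^'n \<Rightarrow> real^'n \<Rightarrow> real^'n \<Rightarrow> real^'n" where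
  "christoffel g p u v = (\<chi> k. \<Sum>i\<in>UNIV. \<Sum>j\<in>UNIV. christoffel_symbol g p k i j * u $ i * v $ j)"

text \<open>The Levi-Civita connection on vector fields.\<close>

definition nabla ::
    "(real^'n \<Rightarrow> real^'n \<Rightarrow> real^'n \<Rightarrow> real) \<Rightarrow> (real^'n \<Rightarrow> real^'n) \<Rightarrow> (real^'n \<Rightarrow> real^'n)
      \<Rightarrow> real^'n \<Rightarrow> real^'n" where
  "nabla g X Y p = frechet_derivative Y (at p) (X p) + christoffel g p (X p) (Y p)"

definition lie_bracket ::
    "(real^'n \<Rightarrow> real^'n) \<Rightarrow> (real^'n \<Rightarrow> real^'n) \<Rightarrow> real^'n \<Rightarrow> real^'n" where
  "lie_bracket X Y p = frechet_derivative Y (at p) (X p) - frechet_derivative X (at p) (Y p)"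

definition curvature_field ::
    "(real^'n \<Rightarrow> real^'n \<Rightarrow> real^'n \<Rightarrow> real) \<Rightarrow> (real^'n \<Rightarrow> real^'n) \<Rightarrow> (real^'n \<Rightarrow> real^'n)
      \<Rightarrow> (real^'n \<Rightarrow> real^'n) \<Rightarrow> real^'n \<Rightarrow> real^'n" where
  "curvature_field g X Y Z p =
     nabla g X (nabla g Y Z) p - nabla g Y (nabla g X Z) p - nabla g (lie_bracket X Y) Z p"

text \<open>The curvature is tensorial, so on tangent vectors at \<open>p\<close> it may be evaluated on any vector
  fields extending them; we take those with constant coordinate components.\<close>

definition curvature ::
    "(real^'n \<Rightarrow> real^'n \<Rightarrow> real^'n \<Rightarrow> real) \<Rightarrow> real^'n \<Rightarrow> real^'n \<Rightarrow> real^'n \<Rightarrow> real^'n \<Rightarrow> real^'n" where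
  "curvature g p u v w = curvature_field g (\<lambda>_. u) (\<lambda>_. v) (\<lambda>_. w) p"


section \<open>Curves on an interval\<close>

text \<open>All derivatives are taken within the parameter interval \<open>I\<close>, hence are one-sided at
  endpoints belonging to \<open>I\<close>.\<close>

definition der_on :: "real set \<Rightarrow> (real \<Rightarrow> 'a::real_normed_vector) \<Rightarrow> real \<Rightarrow> 'a" where
  "der_on I f s = vector_derivative f (at s within I)"

definition smooth_on_interval :: "real set \<Rightarrow> (real \<Rightarrow> 'a::real_normed_vector) \<Rightarrow> bool" where
  "smooth_on_interval I f \<longleftrightarrow> (\<forall>k. (der_on I ^^ k) f differentiable_on I)"

definition cov_deriv ::
    "(real^'n \<Rightarrow> real^'n \<Rightarrow> real^'n \<Rightarrow> real) \<Rightarrow> real set \<Rightarrow> (real \<Rightarrow> real^'n) \<Rightarrow> (real \<Rightarrow> real^'n)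
      \<Rightarrow> real \<Rightarrow> real^'n" where
  "cov_deriv g I \<gamma> V s = der_on I V s + christoffel g (\<gamma> s) (der_on I \<gamma> s) (V s)"

definition nabla_T_pow ::
    "(real^'n \<Rightarrow> real^'n \<Rightarrow> real^'n \<Rightarrow> real) \<Rightarrow> real set \<Rightarrow> (real \<Rightarrow> real^'n) \<Rightarrow> nat
      \<Rightarrow> real \<Rightarrow> real^'n" where
  "nabla_T_pow g I \<gamma> k = (cov_deriv g I \<gamma> ^^ k) (der_on I \<gamma>)"

definition r_tension ::
    "(real^'n \<Rightarrow> real^'n \<Rightarrow> real^'n \<Rightarrow> real) \<Rightarrow> nat \<Rightarrow> real set \<Rightarrow> (real \<Rightarrow> real^'n)
      \<Rightarrow> real \<Rightarrow> real^'n" where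
  "r_tension g r I \<gamma> s =
     nabla_T_pow g I \<gamma> (2*r - 1) s
     + (\<Sum>j=0..r-2. (-1)^j *\<^sub>R
          curvature g (\<gamma> s) (nabla_T_pow g I \<gamma> (2*r - 3 - j) s) (nabla_T_pow g I \<gamma> j s)
            (der_on I \<gamma> s))"

definition r_harmonic ::
    "(real^'n \<Rightarrow> real^'n \<Rightarrow> real^'n \<Rightarrow> real) \<Rightarrow> nat \<Rightarrow> real set \<Rightarrow> (real \<Rightarrow> real^'n) \<Rightarrow> bool" where
  "r_harmonic g r I \<gamma> \<longleftrightarrow> (\<forall>s\<in>I. r_tension g r I \<gamma> s = 0)"

definition geodesic ::
    "(real^'n \<Rightarrow> real^'n \<Rightarrow> real^'n \<Rightarrow> real) \<Rightarrow> real set \<Rightarrow> (real \<Rightarrow> real^'n) \<Rightarrow> bool" where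
  "geodesic g I \<gamma> \<longleftrightarrow> (\<forall>s\<in>I. cov_deriv g I \<gamma> (der_on I \<gamma>) s = 0)"

definition proper_r_harmonic ::
    "(real^'n \<Rightarrow> real^'n \<Rightarrow> real^'n \<Rightarrow> real) \<Rightarrow> nat \<Rightarrow> real set \<Rightarrow> (real \<Rightarrow> real^'n) \<Rightarrow> bool" where
  "proper_r_harmonic g r I \<gamma> \<longleftrightarrow> r_harmonic g r I \<gamma> \<and> \<not> geodesic g I \<gamma>"

definition arc_length_curve ::
    "(real^'n) set \<Rightarrow> (real^'n \<Rightarrow> real^'n \<Rightarrow> real^'n \<Rightarrow> real) \<Rightarrow> real set \<Rightarrow> (real \<Rightarrow> real^'n) \<Rightarrow> bool" where
  "arc_length_curve M g I \<gamma> \<longleftrightarrow>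
     is_interval I \<and> (\<exists>a\<in>I. \<exists>b\<in>I. a < b) \<and> smooth_on_interval I \<gamma> \<and> \<gamma> ` I \<subseteq> M \<and>
     (\<forall>s\<in>I. g (\<gamma> s) (der_on I \<gamma> s) (der_on I \<gamma> s) = 1)"


section \<open>The Bianchi-Cartan-Vranceanu spaces\<close>

definition bcv_F :: "real \<Rightarrow> real^3 \<Rightarrow> real" where
  "bcv_F m p = 1 + m * ((p$1)^2 + (p$2)^2)"

definition bcv_space :: "real \<Rightarrow> (real^3) set" where
  "bcv_space m = {p. bcv_F m p > 0}"

definition bcv_metric :: "real \<Rightarrow> real \<Rightarrow> real^3 \<Rightarrow> real^3 \<Rightarrow> real^3 \<Rightarrow> real" where
  "bcv_metric m l p u v =
     (u$1 * v$1 + u$2 * v$2) / (bcv_F m p)^2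
     + (u$3 + l/2 * ((p$2 * u$1 - p$1 * u$2) / bcv_F m p))
       * (v$3 + l/2 * ((p$2 * v$1 - p$1 * v$2) / bcv_F m p))"

definition bcv_E1 :: "real \<Rightarrow> real \<Rightarrow> real^3 \<Rightarrow> real^3" where
  "bcv_E1 m l p = vector [bcv_F m p, 0, - (l * p$2 / 2)]"

definition bcv_E2 :: "real \<Rightarrow> real \<Rightarrow> real^3 \<Rightarrow> real^3" where
  "bcv_E2 m l p = vector [0, bcv_F m p, l * p$1 / 2]"

definition bcv_E3 :: "real^3 \<Rightarrow> real^3" where
  "bcv_E3 p = vector [0, 0, 1]"

definition bcv_components :: "real \<Rightarrow> real \<Rightarrow> real^3 \<Rightarrow> real^3 \<Rightarrow> real^3" where
  "bcv_components m l p u =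
     vector [bcv_metric m l p u (bcv_E1 m l p), bcv_metric m l p u (bcv_E2 m l p),
             bcv_metric m l p u (bcv_E3 p)]"

text \<open>The vector product of the tangent space at \<open>p\<close>, for the metric and for the orientation in
  which the orthonormal frame \<open>E1, E2, E3\<close> is positive.\<close>

definition bcv_wedge :: "real \<Rightarrow> real \<Rightarrow> real^3 \<Rightarrow> real^3 \<Rightarrow> real^3 \<Rightarrow> real^3" where
  "bcv_wedge m l p u v =
     (let w = cross3 (bcv_components m l p u) (bcv_components m l p v)
      in w$1 *\<^sub>R bcv_E1 m l p + w$2 *\<^sub>R bcv_E2 m l p + w$3 *\<^sub>R bcv_E3 p)"

text \<open>Given that \<open>T\<close>, \<open>N\<close> are orthonormal, the condition \<open>B = T \<and> N\<close> says exactly that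
  \<open>T, N, B\<close> is orthonormal and positively oriented.\<close>

definition frenet_helix_frame ::
    "real \<Rightarrow> real \<Rightarrow> real set \<Rightarrow> (real \<Rightarrow> real^3) \<Rightarrow> (real \<Rightarrow> real^3) \<Rightarrow> (real \<Rightarrow> real^3)
      \<Rightarrow> real \<Rightarrow> real \<Rightarrow> bool" where
  "frenet_helix_frame m l I \<gamma> N B \<kappa> \<tau> \<longleftrightarrow>
     arc_length_curve (bcv_space m) (bcv_metric m l) I \<gamma> \<and>
     smooth_on_interval I N \<and> smooth_on_interval I B \<and> \<kappa> > 0 \<and>
     (\<forall>s\<in>I.
        bcv_metric m l (\<gamma> s) (N s) (N s) = 1 \<and>
        bcv_metric m l (\<gamma> s) (der_on I \<gamma> s) (N s) = 0 \<and>
        B s = bcv_wedge m l (\<gamma> s) (der_on I \<gamma> s) (N s) \<and>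
        cov_deriv (bcv_metric m l) I \<gamma> (der_on I \<gamma>) s = \<kappa> *\<^sub>R N s \<and>
        cov_deriv (bcv_metric m l) I \<gamma> N s = - \<kappa> *\<^sub>R der_on I \<gamma> s + \<tau> *\<^sub>R B s \<and>
        cov_deriv (bcv_metric m l) I \<gamma> B s = - \<tau> *\<^sub>R N s)"

definition frenet_helix3 :: "real \<Rightarrow> real \<Rightarrow> real set \<Rightarrow> (real \<Rightarrow> real^3) \<Rightarrow> bool" where
  "frenet_helix3 m l I \<gamma> \<longleftrightarrow> (\<exists>N B \<kappa> \<tau>. frenet_helix_frame m l I \<gamma> N B \<kappa> \<tau>)"


section \<open>Helices with horizontal normal\<close>

definition adapted_angles ::
    "real \<Rightarrow> real \<Rightarrow> real \<Rightarrow> real \<Rightarrow> real set \<Rightarrow> (real \<Rightarrow> real^3) \<Rightarrow> (real \<Rightarrow> real^3) \<Rightarrow> (real \<Rightarrow> real)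
      \<Rightarrow> bool" where
  "adapted_angles m l \<alpha> \<zeta> I \<gamma> N \<beta> \<longleftrightarrow>
     smooth_on_interval I \<beta> \<and>
     (\<forall>s\<in>I.
        der_on I \<gamma> s = (sin \<alpha> * cos (\<beta> s)) *\<^sub>R bcv_E1 m l (\<gamma> s)
          + (sin \<alpha> * sin (\<beta> s)) *\<^sub>R bcv_E2 m l (\<gamma> s) + cos \<alpha> *\<^sub>R bcv_E3 (\<gamma> s) \<and>
        N s = - sin (\<beta> s) *\<^sub>R bcv_E1 m l (\<gamma> s) + cos (\<beta> s) *\<^sub>R bcv_E2 m l (\<gamma> s) \<and>
        \<zeta> = \<bar>der_on I \<beta> s + 2 * m * sin \<alpha> * (\<gamma> s $ 2 * cos (\<beta> s) - \<gamma> s $ 1 * sin (\<beta> s))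
              - l * cos \<alpha>\<bar>)"

definition z_slope :: "real \<Rightarrow> real \<Rightarrow> real \<Rightarrow> real \<Rightarrow> real" where
  "z_slope m l \<alpha> \<zeta> = 1 / (4*m) * ((4*m - l^2) * cos \<alpha> - l * \<zeta>)"

text \<open>In the following type, \<open>T = \<gamma>'\<close> forces \<open>bcv_F m (\<gamma> s) = \<mu> * \<beta>'(s)\<close>, so \<open>\<mu>\<close> has the (constant)
  sign of \<open>\<beta>'\<close>. Both signs occur. The same identity determines the factor \<open>2 m sin \<alpha>\<close> in the equation
  for \<open>\<beta>\<close>. The constant \<open>c3\<close> accounts for the translations along the \<open>z\<close>-axis.\<close>

definition helix_type_I ::
    "real \<Rightarrow> real \<Rightarrow> real \<Rightarrow> real \<Rightarrow> real set \<Rightarrow> (real \<Rightarrow> real^3) \<Rightarrow> (real \<Rightarrow> real) \<Rightarrow> bool" where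
  "helix_type_I m l \<alpha> \<zeta> I \<gamma> \<beta> \<longleftrightarrow>
     (\<exists>\<mu> c1 c2 c3. \<mu> \<noteq> 0 \<and>
        c1^2 + c2^2 = \<mu>/m * ((l * cos \<alpha> + \<zeta> - 1/\<mu>) + m * \<mu> * (sin \<alpha>)^2) \<and>
        \<not> (\<exists>\<beta>\<^sub>o. \<forall>s\<in>I. \<beta> s = \<beta>\<^sub>o) \<and>
        (\<forall>s\<in>I.
           der_on I \<beta> s = 2 * m * sin \<alpha> * (c1 * sin (\<beta> s) - c2 * cos (\<beta> s))
             + 2 * m * \<mu> * (sin \<alpha>)^2 + \<zeta> + l * cos \<alpha> \<and>
           \<gamma> s $ 1 = \<mu> * sin \<alpha> * sin (\<beta> s) + c1 \<and>
           \<gamma> s $ 2 = - (\<mu> * sin \<alpha> * cos (\<beta> s)) + c2 \<and>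
           \<gamma> s $ 3 = l / (4*m) * \<beta> s + z_slope m l \<alpha> \<zeta> * s + c3))"

definition helix_type_II ::
    "real \<Rightarrow> real \<Rightarrow> real \<Rightarrow> real \<Rightarrow> real set \<Rightarrow> (real \<Rightarrow> real^3) \<Rightarrow> (real \<Rightarrow> real) \<Rightarrow> bool" where
  "helix_type_II m l \<alpha> \<zeta> I \<gamma> \<beta> \<longleftrightarrow>
     (\<exists>\<beta>\<^sub>o c1 c2. sin \<beta>\<^sub>o * cos \<beta>\<^sub>o \<noteq> 0 \<and>
        c1 = (\<zeta> + l * cos \<alpha>) / (2 * m * sin \<alpha> * cos \<beta>\<^sub>o) \<and>
        (\<forall>s\<in>I.
           \<beta> s = \<beta>\<^sub>o \<and>
           der_on I (\<lambda>t. \<gamma> t $ 1) s =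
             (1 + m * ((\<gamma> s $ 1)^2 + (\<gamma> s $ 1 * tan \<beta>\<^sub>o + c1)^2)) * sin \<alpha> * cos \<beta>\<^sub>o \<and>
           \<gamma> s $ 2 = \<gamma> s $ 1 * tan \<beta>\<^sub>o + c1 \<and>
           \<gamma> s $ 3 = z_slope m l \<alpha> \<zeta> * s + c2))"

text \<open>Only the class of \<open>\<beta>\<^sub>o\<close> modulo \<open>2 \<pi>\<close> matters, which leaves the four values
  \<open>\<pi>/2, 3\<pi>/2, 0, \<pi>\<close>. The sign factors come from
  \<open>2 m sin \<alpha> (y cos \<beta>\<^sub>o - x sin \<beta>\<^sub>o) - l cos \<alpha> = \<zeta>\<close>.\<close>

definition helix_type_III ::
    "real \<Rightarrow> real \<Rightarrow> real \<Rightarrow> real \<Rightarrow> real set \<Rightarrow> (real \<Rightarrow> real^3) \<Rightarrow> (real \<Rightarrow> real) \<Rightarrow> bool" where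
  "helix_type_III m l \<alpha> \<zeta> I \<gamma> \<beta> \<longleftrightarrow>
     (\<exists>\<beta>\<^sub>o c1. sin \<beta>\<^sub>o * cos \<beta>\<^sub>o = 0 \<and>
        (\<forall>s\<in>I. \<beta> s = \<beta>\<^sub>o \<and> \<gamma> s $ 3 = z_slope m l \<alpha> \<zeta> * s + c1) \<and>
        (cos \<beta>\<^sub>o = 0 \<and>
           (\<exists>x\<^sub>o. x\<^sub>o = - sin \<beta>\<^sub>o * ((\<zeta> + l * cos \<alpha>) / (2 * m * sin \<alpha>)) \<and>
             (\<forall>s\<in>I. \<gamma> s $ 1 = x\<^sub>o \<and>
               (der_on I (\<lambda>t. \<gamma> t $ 2) s)^2 = (1 + m * (x\<^sub>o^2 + (\<gamma> s $ 2)^2))^2 * (sin \<alpha>)^2))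
         \<or> sin \<beta>\<^sub>o = 0 \<and>
           (\<exists>y\<^sub>o. y\<^sub>o = cos \<beta>\<^sub>o * ((\<zeta> + l * cos \<alpha>) / (2 * m * sin \<alpha>)) \<and>
             (\<forall>s\<in>I. \<gamma> s $ 2 = y\<^sub>o \<and>
               (der_on I (\<lambda>t. \<gamma> t $ 1) s)^2 = (1 + m * ((\<gamma> s $ 1)^2 + y\<^sub>o^2))^2 * (sin \<alpha>)^2))))"

definition horizontal_normal_helix_of_type ::
    "real \<Rightarrow> real \<Rightarrow> real \<Rightarrow> real \<Rightarrow> real set \<Rightarrow> (real \<Rightarrow> real^3) \<Rightarrow> bool" where
  "horizontal_normal_helix_of_type m l \<alpha> \<zeta> I \<gamma> \<longleftrightarrow>
     (\<exists>N B \<kappa> \<tau> \<beta>. frenet_helix_frame m l I \<gamma> N B \<kappa> \<tau> \<and>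
        (\<forall>s\<in>I. bcv_metric m l (\<gamma> s) (N s) (bcv_E3 (\<gamma> s)) = 0) \<and>
        adapted_angles m l \<alpha> \<zeta> I \<gamma> N \<beta> \<and>
        (helix_type_I m l \<alpha> \<zeta> I \<gamma> \<beta> \<or> helix_type_II m l \<alpha> \<zeta> I \<gamma> \<beta> \<or>
         helix_type_III m l \<alpha> \<zeta> I \<gamma> \<beta>))"

definition P4 :: "nat \<Rightarrow> real \<Rightarrow> real \<Rightarrow> real \<Rightarrow> real poly" where
  "P4 r m l \<alpha> =
     [: - 2 * l^2 * (4*m - l^2) * (sin \<alpha>)^2,
        2 * l * cos \<alpha> * (l^2 - 2 * real r * (4*m - l^2) * (sin \<alpha>)^2),
        cos (2*\<alpha>) * (16 * m * (real r - 1) - 3 * l^2 * (real r - 2))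
          - 16 * m * (real r - 1) + l^2 * (3 * real r + 4),
        16 * l * cos \<alpha>,
        8 :]"

end

theory Submission
  imports Defs
begin

text \<open>In the orthonormal frame \<open>E1, E2, E3\<close> the curvature is \<open>R(X,Y)Z = Z \<and> S (X \<and> Y)\<close> with \<open>S\<close> diagonal.
  Along a helix the iterated covariant derivatives of \<open>T\<close> alternate between multiples of \<open>N\<close> and of
  \<open>\<tau> B - \<kappa> T\<close>, so the \<open>r\<close>-tension field is a nonzero multiple of \<open>\<rho>\<^sup>4 N + T \<and> S V\<close>, where
  \<open>\<rho>\<^sup>2 = \<kappa>\<^sup>2 + \<tau>\<^sup>2\<close> and \<open>V = (\<rho>\<^sup>2 + (r-2) \<kappa>\<^sup>2) B + (r-2) \<kappa> \<tau> T\<close>. Its \<open>B\<close>-component forces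
  \<open>V3 = 0\<close> or \<open>N3 = 0\<close>; differentiating \<open>V3 = 0\<close> where \<open>N3 \<noteq> 0\<close> leads to a contradiction. Hence \<open>N3 = 0\<close>,
  \<open>T3 = cos \<alpha>\<close> and \<open>B3 = sin \<alpha>\<close> are constant (after reversing the curve if \<open>B3 < 0\<close>), and the
  \<open>N\<close>-component is the polynomial equation. The three types come from the identity
  \<open>\<beta>' = c F\<close> with a constant \<open>c\<close>.\<close>

section \<open>The Levi-Civita connection of the BCV spaces\<close>

text \<open>Connection and curvature are defined in coordinates, while the argument lives in the
  frame. To bridge the two, closed forms are verified rather than derived: an identity that does not
  hold outright holds modulo the single relation \<open>m * G * (x^2 + y^2) = 1 - G\<close>, where
  \<open>G\<close> is the inverse of F, and its cofactor is written out. The factor r - 2 in V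
  counts the curvature summands with j > 0. They all coincide, because the sign (-1)^j compensates
  for the order of the two factors in the bivector. The contradiction for nonzero N3 is
  quantitative: the derivative of V3 = 0 and the N-component together give (r - 1) \<kappa>^2 +
  \<tau>^2 = \<tau>^2, against \<kappa> > 0. Reversal enters because \<kappa> > 0 determines N,
  hence also B = T \<and> N, so B3 may be negative, whereas \<alpha> in (0, \<pi>) prescribes B3 =
  sin \<alpha> > 0. Reversing negates T and B and keeps N, \<kappa> and \<tau>.\<close>

lemma matrix_inv_left:
  fixes A :: "real^'n^'n"
  assumes "invertible A"
  shows "matrix_inv A ** A = mat 1"
  using someI_ex[OF assms[unfolded invertible_def]] by (simp add: matrix_inv_def)

text \<open>Multiplying Koszul's equation by the inverse metric matrix isolates the Christoffel
  term, so a candidate \<open>c\<close> can be verified without computing that inverse.\<close>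

lemma christoffel_eqI:
  fixes g :: "real^'n \<Rightarrow> real^'n \<Rightarrow> real^'n \<Rightarrow> real"
  assumes inv: "invertible (metric_matrix g p)"
    and eq: "\<And>h. (metric_matrix g p *v c) $ h = (1/2) * (\<Sum>i\<in>UNIV. \<Sum>j\<in>UNIV.
        (partial_deriv i (\<lambda>q. metric_matrix g q $ j $ h) p
         + partial_deriv j (\<lambda>q. metric_matrix g q $ i $ h) p
         - partial_deriv h (\<lambda>q. metric_matrix g q $ i $ j) p) * u $ i * v $ j)"
  shows "christoffel g p u v = c"
proof -
  let ?d = "\<lambda>i j h. partial_deriv i (\<lambda>q. metric_matrix g q $ j $ h) p
         + partial_deriv j (\<lambda>q. metric_matrix g q $ i $ h) p
         - partial_deriv h (\<lambda>q. metric_matrix g q $ i $ j) p"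
  let ?M = "matrix_inv (metric_matrix g p)"
  have "christoffel g p u v $ k = c $ k" for k
  proof -
    have "christoffel g p u v $ k
        = (\<Sum>i\<in>UNIV. \<Sum>j\<in>UNIV. \<Sum>h\<in>UNIV. ?M $ k $ h * ((1/2) * (?d i j h * u $ i * v $ j)))"
      unfolding christoffel_def christoffel_symbol_def
      by (simp add: sum_distrib_left sum_distrib_right mult_ac)
    also have "\<dots> = (\<Sum>i\<in>UNIV. \<Sum>h\<in>UNIV. \<Sum>j\<in>UNIV. ?M $ k $ h * ((1/2) * (?d i j h * u $ i * v $ j)))"
      by (intro sum.cong refl sum.swap)
    also have "\<dots> = (\<Sum>h\<in>UNIV. \<Sum>i\<in>UNIV. \<Sum>j\<in>UNIV. ?M $ k $ h * ((1/2) * (?d i j h * u $ i * v $ j)))"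
      by (rule sum.swap)
    also have "\<dots> = (\<Sum>h\<in>UNIV. ?M $ k $ h * (metric_matrix g p *v c) $ h)"
      by (simp add: eq sum_distrib_left)
    also have "\<dots> = (?M *v (metric_matrix g p *v c)) $ k"
      by (simp add: matrix_vector_mult_def)
    also have "\<dots> = c $ k"
      using matrix_inv_left[OF inv] by (simp add: matrix_vector_mul_assoc)
    finally show ?thesis .
  qed
  then show ?thesis by (simp add: vec_eq_iff)
qed

lemma christoffel_add_right:
  "christoffel g p u (v + w) = christoffel g p u v + christoffel g p u w"
  by (simp add: christoffel_def vec_eq_iff distrib_left sum.distrib)

lemma christoffel_scaleR_right:
  "christoffel g p u (c *\<^sub>R v) = c *\<^sub>R christoffel g p u v"
  by (simp add: christoffel_def vec_eq_iff sum_distrib_left mult_ac)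

section \<open>Components in the orthonormal frame\<close>

lemma bcv_components_eq:
  assumes "bcv_F m p \<noteq> 0"
  shows "bcv_components m l p u
    = vector [u$1 / bcv_F m p, u$2 / bcv_F m p, u$3 + l/2 * ((p$2 * u$1 - p$1 * u$2) / bcv_F m p)]"
  using assms
  by (simp add: bcv_components_def bcv_metric_def bcv_E1_def bcv_E2_def bcv_E3_def vec_eq_iff forall_3
      power2_eq_square field_simps)

lemma bcv_components_nth:
  assumes "bcv_F m p \<noteq> 0"
  shows "bcv_components m l p u $ 1 = u$1 / bcv_F m p"
    and "bcv_components m l p u $ 2 = u$2 / bcv_F m p"
    and "bcv_components m l p u $ 3 = u$3 + l/2 * ((p$2 * u$1 - p$1 * u$2) / bcv_F m p)"
  by (simp_all add: bcv_components_eq[OF assms])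

lemma inner_3: "(u::real^3) \<bullet> v = u$1 * v$1 + u$2 * v$2 + u$3 * v$3"
  by (simp add: inner_vec_def sum_3)

lemma bcv_metric_eq_inner:
  assumes "bcv_F m p \<noteq> 0"
  shows "bcv_metric m l p u v = bcv_components m l p u \<bullet> bcv_components m l p v"
  using assms by (simp add: bcv_metric_def bcv_components_eq inner_3 power2_eq_square add_divide_distrib)

text \<open>Inverse of \<open>bcv_components\<close> where \<open>bcv_F\<close> is nonzero. Passing
  to components turns the metric into the Euclidean inner product and \<open>bcv_wedge\<close> into
  \<open>cross3\<close>.\<close>

definition bcv_vector :: "real \<Rightarrow> real \<Rightarrow> real^3 \<Rightarrow> real^3 \<Rightarrow> real^3" where
  "bcv_vector m l p a = a$1 *\<^sub>R bcv_E1 m l p + a$2 *\<^sub>R bcv_E2 m l p + a$3 *\<^sub>R bcv_E3 p"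

lemma bcv_vector_nth:
  "bcv_vector m l p a $ 1 = bcv_F m p * a$1"
  "bcv_vector m l p a $ 2 = bcv_F m p * a$2"
  "bcv_vector m l p a $ 3 = a$3 + l/2 * (p$1 * a$2 - p$2 * a$1)"
  by (simp_all add: bcv_vector_def bcv_E1_def bcv_E2_def bcv_E3_def algebra_simps)

lemma bcv_components_vector [simp]:
  assumes "bcv_F m p \<noteq> 0"
  shows "bcv_components m l p (bcv_vector m l p a) = a"
  using assms by (simp add: bcv_components_eq bcv_vector_nth vec_eq_iff forall_3 field_simps)

lemma bcv_vector_components [simp]:
  assumes "bcv_F m p \<noteq> 0"
  shows "bcv_vector m l p (bcv_components m l p u) = u"
  using assms by (simp add: bcv_components_eq bcv_vector_nth vec_eq_iff forall_3 field_simps)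

lemma linear_bcv_components:
  assumes "bcv_F m p \<noteq> 0"
  shows "linear (bcv_components m l p)"
  by (rule linearI)
    (simp_all add: bcv_components_eq[OF assms] vec_eq_iff forall_3 add_divide_distrib diff_divide_distrib
      algebra_simps)

lemma bcv_components_wedge:
  assumes "bcv_F m p \<noteq> 0"
  shows "bcv_components m l p (bcv_wedge m l p u v)
    = cross3 (bcv_components m l p u) (bcv_components m l p v)"
  using assms bcv_components_vector[of m p l]
  by (simp add: bcv_wedge_def Let_def flip: bcv_vector_def)

lemma bcv_components_eq_0_iff:
  assumes "bcv_F m p \<noteq> 0"
  shows "bcv_components m l p u = 0 \<longleftrightarrow> u = 0"
  using assms linear_0[OF linear_bcv_components[OF assms]] bcv_vector_components[OF assms]
  by (metis)

lemma open_bcv_space: "open (bcv_space m)"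
  unfolding bcv_space_def bcv_F_def
  by (intro open_Collect_less continuous_intros)

section \<open>Derivatives of the metric and Koszul's formula\<close>

lemma has_derivative_vec_nth: "((\<lambda>q. q $ i) has_derivative (\<lambda>h. h $ i)) F"
  by (rule bounded_linear_imp_has_derivative[OF bounded_linear_vec_nth])

lemma has_derivative_inverse_bcv_F:
  assumes "bcv_F m p \<noteq> 0"
  shows "((\<lambda>q. inverse (bcv_F m q)) has_derivative
    (\<lambda>w. - 2 * m * (p$1 * w$1 + p$2 * w$2) * (inverse (bcv_F m p))^2)) (at p)"
  using assms unfolding bcv_F_def
  by (auto intro!: derivative_eq_intros bounded_linear.has_derivative[OF bounded_linear_vec_nth]
      simp: power2_eq_square algebra_simps)

text \<open>Directional derivative of the metric on fixed coordinate vectors \<open>u\<close>,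
  \<open>v\<close>; the first vector argument \<open>w\<close> is the direction.\<close>

definition bcv_dmetric :: "real \<Rightarrow> real \<Rightarrow> real^3 \<Rightarrow> real^3 \<Rightarrow> real^3 \<Rightarrow> real^3 \<Rightarrow> real" where
  "bcv_dmetric m l p w u v = (let G = inverse (bcv_F m p); x = p$1; y = p$2;
       dG = - 2 * m * (x * w$1 + y * w$2) * G^2;
       du = l/2 * ((w$2 * u$1 - w$1 * u$2) * G + (y * u$1 - x * u$2) * dG);
       dv = l/2 * ((w$2 * v$1 - w$1 * v$2) * G + (y * v$1 - x * v$2) * dG)
     in 2 * G * dG * (u$1 * v$1 + u$2 * v$2)
       + du * (v$3 + l/2 * (y * v$1 - x * v$2) * G) + (u$3 + l/2 * (y * u$1 - x * u$2) * G) * dv)"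

lemma has_derivative_bcv_metric:
  assumes "bcv_F m p \<noteq> 0"
  shows "((\<lambda>q. bcv_metric m l q u v) has_derivative (\<lambda>w. bcv_dmetric m l p w u v)) (at p)"
proof -
  have "(\<lambda>q. bcv_metric m l q u v) = (\<lambda>q. (u$1 * v$1 + u$2 * v$2) * (inverse (bcv_F m q))^2
     + (u$3 + l/2 * ((q$2 * u$1 - q$1 * u$2) * inverse (bcv_F m q)))
       * (v$3 + l/2 * ((q$2 * v$1 - q$1 * v$2) * inverse (bcv_F m q))))"
    unfolding bcv_metric_def divide_inverse power_inverse ..
  moreover have "(\<dots> has_derivative (\<lambda>w. bcv_dmetric m l p w u v)) (at p)"
    by (rule has_derivative_eq_rhs,
        (rule has_derivative_inverse_bcv_F[OF assms] has_derivative_vec_nth derivative_intros)+,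
        simp add: bcv_dmetric_def Let_def fun_eq_iff, simp add: algebra_simps power2_eq_square)
  ultimately show ?thesis by simp
qed

text \<open>The local \<open>u3\<close> and \<open>v3\<close> are the \<open>E3\<close>-components
  of \<open>u\<close> and \<open>v\<close>; expressed through them, the terms mixing base and fibre
  stay short.\<close>

definition bcv_christoffel :: "real \<Rightarrow> real \<Rightarrow> real^3 \<Rightarrow> real^3 \<Rightarrow> real^3 \<Rightarrow> real^3" where
  "bcv_christoffel m l p u v = (let G = inverse (bcv_F m p); x = p$1; y = p$2;
       u3 = u$3 + l/2 * (y * u$1 - x * u$2) * G; v3 = v$3 + l/2 * (y * v$1 - x * v$2) * G
     in vector [
       - 2 * m * G * (x * (u$1 * v$1 - u$2 * v$2) + y * (u$1 * v$2 + u$2 * v$1))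
         + l/2 * (u$2 * v3 + v$2 * u3),
       - 2 * m * G * (y * (u$2 * v$2 - u$1 * v$1) + x * (u$1 * v$2 + u$2 * v$1))
         - l/2 * (u$1 * v3 + v$1 * u3),
       l/2 * m * G^2 * (2 * x * y * (u$1 * v$1 - u$2 * v$2) + (y^2 - x^2) * (u$1 * v$2 + u$2 * v$1))
         - l^2/4 * G * ((x * u$1 + y * u$2) * v3 + (x * v$1 + y * v$2) * u3)])"

text \<open>A kernel vector has zero length, and length is the Euclidean norm of the frame
  components, so the kernel is trivial.\<close>

lemma invertible_bcv_metric_matrix:
  assumes "bcv_F m p \<noteq> 0"
  shows "invertible (metric_matrix (bcv_metric m l) p)"
    and "(metric_matrix (bcv_metric m l) p *v c) $ h = bcv_metric m l p (axis h 1) c"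
proof -
  have *: "(metric_matrix (bcv_metric m l) p *v c) $ h = bcv_metric m l p (axis h 1) c" for c h
    by (simp add: matrix_vector_mult_def metric_matrix_def sum_3 bcv_metric_def axis_def)
      (simp add: add_divide_distrib diff_divide_distrib algebra_simps)
  then show "(metric_matrix (bcv_metric m l) p *v c) $ h = bcv_metric m l p (axis h 1) c" .
  have "c = 0" if "metric_matrix (bcv_metric m l) p *v c = 0" for c
  proof -
    have z: "bcv_metric m l p (axis h 1) c = 0" for h
      using *[of c h] that by simp
    have "bcv_metric m l p c c = c$1 * bcv_metric m l p (axis 1 1) c
        + c$2 * bcv_metric m l p (axis 2 1) c + c$3 * bcv_metric m l p (axis 3 1) c"
      by (simp add: bcv_metric_def axis_def) (simp add: add_divide_distrib diff_divide_distrib algebra_simps)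
    then have "bcv_metric m l p c c = 0" by (simp add: z)
    then show ?thesis
      using assms by (simp add: bcv_metric_eq_inner bcv_components_eq_0_iff)
  qed
  then show "invertible (metric_matrix (bcv_metric m l) p)"
    by (simp add: invertible_left_inverse matrix_left_invertible_ker)
qed

text \<open>Koszul's formula for fields with constant coordinates: their brackets vanish and only
  derivatives of the metric remain. As the metric is nondegenerate, this characterizes the
  Christoffel term.\<close>

lemma bcv_koszul:
  assumes "bcv_F m p \<noteq> 0"
  shows "2 * bcv_metric m l p w (bcv_christoffel m l p u v)
    = bcv_dmetric m l p u v w + bcv_dmetric m l p v u w - bcv_dmetric m l p w u v"
proof -
  define G where "G = inverse (bcv_F m p)"
  define k where "k = l/2"
  obtain x y where xy: "p$1 = x" "p$2 = y" by blast
  obtain u1 u2 u3 v1 v2 v3 w1 w2 w3 where uvw: "u$1 = u1" "u$2 = u2" "u$3 = u3"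
    "v$1 = v1" "v$2 = v2" "v$3 = v3" "w$1 = w1" "w$2 = w2" "w$3 = w3" by blast
  have FG: "m * G * (x^2 + y^2) - (1 - G) = 0"
    using assms by (simp add: G_def bcv_F_def xy field_simps)
  have l: "l^2/4 = k^2" by (simp add: k_def power2_eq_square)
  \<comment> \<open>The equation only holds modulo \<open>F * G = 1\<close>; the right-hand side gives the cofactor explicitly.\<close>
  have "2 * bcv_metric m l p w (bcv_christoffel m l p u v)
      - (bcv_dmetric m l p u v w + bcv_dmetric m l p v u w - bcv_dmetric m l p w u v)
    = 2 * k * G * ((v3 + k * (y * v1 - x * v2) * G) * (u2 * w1 - u1 * w2)
        + (u3 + k * (y * u1 - x * u2) * G) * (v2 * w1 - v1 * w2))
      * (m * G * (x^2 + y^2) - (1 - G))"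
    unfolding bcv_metric_def bcv_christoffel_def bcv_dmetric_def Let_def vector_3 divide_inverse
      power_inverse[symmetric] G_def[symmetric] xy uvw l[unfolded divide_inverse]
      k_def[symmetric, unfolded divide_inverse]
    by (simp add: algebra_simps power2_eq_square)
  then show ?thesis by (simp add: FG)
qed

lemma bcv_dmetric_axis_sum:
  "(\<Sum>i\<in>UNIV. \<Sum>j\<in>UNIV. (bcv_dmetric m l p (axis i 1) (axis j 1) (axis h 1)
      + bcv_dmetric m l p (axis j 1) (axis i 1) (axis h 1)
      - bcv_dmetric m l p (axis h 1) (axis i 1) (axis j 1)) * u $ i * v $ j)
    = bcv_dmetric m l p u v (axis h 1) + bcv_dmetric m l p v u (axis h 1)
      - bcv_dmetric m l p (axis h 1) u v"
  using exhaust_3[of h]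
  by (elim disjE; simp add: sum_3 bcv_dmetric_def Let_def axis_def;
      simp add: add_divide_distrib diff_divide_distrib algebra_simps power2_eq_square)

lemma christoffel_bcv:
  assumes "bcv_F m p \<noteq> 0"
  shows "christoffel (bcv_metric m l) p u v = bcv_christoffel m l p u v"
proof (rule christoffel_eqI)
  show "invertible (metric_matrix (bcv_metric m l) p)"
    using assms by (rule invertible_bcv_metric_matrix)
  have pd: "partial_deriv i (\<lambda>q. metric_matrix (bcv_metric m l) q $ j $ h) p
      = bcv_dmetric m l p (axis i 1) (axis j 1) (axis h 1)" for i j h
    unfolding partial_deriv_def metric_matrix_def
    using frechet_derivative_at[OF has_derivative_bcv_metric[OF assms], of l "axis j 1" "axis h 1"]
    by (simp add: fun_eq_iff)
  show "(metric_matrix (bcv_metric m l) p *v bcv_christoffel m l p u v) $ h = (1/2) * (\<Sum>i\<in>UNIV. \<Sum>j\<in>UNIV.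
        (partial_deriv i (\<lambda>q. metric_matrix (bcv_metric m l) q $ j $ h) p
         + partial_deriv j (\<lambda>q. metric_matrix (bcv_metric m l) q $ i $ h) p
         - partial_deriv h (\<lambda>q. metric_matrix (bcv_metric m l) q $ i $ j) p) * u $ i * v $ j)" for h
    using bcv_koszul[OF assms, of l "axis h 1" u v]
    by (simp add: pd bcv_dmetric_axis_sum invertible_bcv_metric_matrix[OF assms])
qed

section \<open>The curvature of the BCV spaces\<close>

lemma has_derivative_vector_3:
  fixes f1 f2 f3 :: "'a::real_normed_vector \<Rightarrow> real"
  assumes "(f1 has_derivative f1') F" "(f2 has_derivative f2') F" "(f3 has_derivative f3') F"
  shows "((\<lambda>q. vector [f1 q, f2 q, f3 q] :: real^3) has_derivative (\<lambda>h. vector [f1' h, f2' h, f3' h])) F"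
proof -
  have *: "vector [a, b, c] = a *\<^sub>R axis 1 1 + b *\<^sub>R axis 2 1 + c *\<^sub>R (axis 3 1 :: real^3)" for a b c :: real
    by (simp add: vec_eq_iff forall_3 axis_def)
  show ?thesis
    unfolding * using assms by (intro has_derivative_add has_derivative_scaleR_left)
qed

definition bcv_dchristoffel :: "real \<Rightarrow> real \<Rightarrow> real^3 \<Rightarrow> real^3 \<Rightarrow> real^3 \<Rightarrow> real^3 \<Rightarrow> real^3" where
  "bcv_dchristoffel m l p h u v = (let G = inverse (bcv_F m p); x = p$1; y = p$2;
       dG = - 2 * m * (x * h$1 + y * h$2) * G^2;
       u3 = u$3 + l/2 * (y * u$1 - x * u$2) * G; v3 = v$3 + l/2 * (y * v$1 - x * v$2) * G;
       du = l/2 * ((h$2 * u$1 - h$1 * u$2) * G + (y * u$1 - x * u$2) * dG);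
       dv = l/2 * ((h$2 * v$1 - h$1 * v$2) * G + (y * v$1 - x * v$2) * dG);
       a = u$1 * v$1 - u$2 * v$2; b = u$1 * v$2 + u$2 * v$1
     in vector [
       - 2 * m * (dG * (x * a + y * b) + G * (h$1 * a + h$2 * b)) + l/2 * (u$2 * dv + v$2 * du),
       - 2 * m * (dG * (x * b - y * a) + G * (h$1 * b - h$2 * a)) - l/2 * (u$1 * dv + v$1 * du),
       l/2 * m * (2 * G * dG * (2 * x * y * a + (y^2 - x^2) * b)
           + G^2 * (2 * (h$1 * y + x * h$2) * a + 2 * (y * h$2 - x * h$1) * b))
         - l^2/4 * (dG * ((x * u$1 + y * u$2) * v3 + (x * v$1 + y * v$2) * u3)
           + G * ((h$1 * u$1 + h$2 * u$2) * v3 + (h$1 * v$1 + h$2 * v$2) * u3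
              + (x * u$1 + y * u$2) * dv + (x * v$1 + y * v$2) * du))])"

lemma has_derivative_bcv_christoffel:
  assumes "bcv_F m p \<noteq> 0"
  shows "((\<lambda>q. bcv_christoffel m l q u v) has_derivative (\<lambda>h. bcv_dchristoffel m l p h u v)) (at p)"
proof -
  define G where "G q = inverse (bcv_F m q)" for q
  define dG where "dG h = - 2 * m * (p$1 * h$1 + p$2 * h$2) * (G p)^2" for h :: "real^3"
  define t where "t w q = w$3 + l/2 * (q$2 * w$1 - q$1 * w$2) * G q" for w q :: "real^3"
  define dt where "dt w h = l/2 * ((h$2 * w$1 - h$1 * w$2) * G p + (p$2 * w$1 - p$1 * w$2) * dG h)"
    for w h :: "real^3"
  define a b where "a = u$1 * v$1 - u$2 * v$2" and "b = u$1 * v$2 + u$2 * v$1"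
  have dG: "(G has_derivative dG) (at p)"
    using has_derivative_inverse_bcv_F[OF assms] by (simp add: G_def[abs_def] dG_def[abs_def])
  have dt: "(t w has_derivative dt w) (at p)" for w
    unfolding t_def[abs_def]
    by (rule has_derivative_eq_rhs, (rule dG has_derivative_vec_nth derivative_intros)+)
      (simp add: fun_eq_iff dt_def algebra_simps)
  show ?thesis
    unfolding bcv_christoffel_def bcv_dchristoffel_def Let_def
      G_def[symmetric] dG_def[symmetric] t_def[symmetric] dt_def[symmetric] a_def[symmetric] b_def[symmetric]
    by (rule has_derivative_vector_3; rule has_derivative_eq_rhs,
        (rule dG dt has_derivative_vec_nth derivative_intros)+,
        simp add: fun_eq_iff a_def b_def add_divide_distrib diff_divide_distrib algebra_simps power2_eq_square)
qed

text \<open>Fields with constant coordinates commute, so the bracket term drops out and the product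
  rule leaves derivatives and compositions of the Christoffel term. The closed form may be
  differentiated in its place because the two agree on the open set
  \<open>bcv_space m\<close>.\<close>

lemma bcv_curvature:
  assumes "p \<in> bcv_space m"
  shows "curvature (bcv_metric m l) p u v w
    = bcv_dchristoffel m l p u v w - bcv_dchristoffel m l p v u w
      + bcv_christoffel m l p u (bcv_christoffel m l p v w)
      - bcv_christoffel m l p v (bcv_christoffel m l p u w)"
proof -
  have F: "bcv_F m q \<noteq> 0" if "q \<in> bcv_space m" for q
    using that by (simp add: bcv_space_def)
  have nabla_const: "nabla (bcv_metric m l) (\<lambda>_. a) (\<lambda>_. b) = (\<lambda>q. christoffel (bcv_metric m l) q a b)" for a b
    by (simp add: nabla_def fun_eq_iff frechet_derivative_const)
  have d: "frechet_derivative (\<lambda>q. christoffel (bcv_metric m l) q a b) (at p) h = bcv_dchristoffel m l p h a b"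
    for a b h
  proof -
    have "((\<lambda>q. christoffel (bcv_metric m l) q a b) has_derivative (\<lambda>h. bcv_dchristoffel m l p h a b)) (at p)"
      by (rule has_derivative_transform_within_open[OF has_derivative_bcv_christoffel open_bcv_space assms])
        (use assms F christoffel_bcv in auto)
    then show ?thesis using frechet_derivative_at by metis
  qed
  have "lie_bracket (\<lambda>_. u) (\<lambda>_. v) = (\<lambda>_. 0)"
    by (simp add: lie_bracket_def fun_eq_iff frechet_derivative_const)
  moreover have "christoffel (bcv_metric m l) p 0 w = 0"
    by (simp add: christoffel_def vec_eq_iff)
  ultimately show ?thesis
    unfolding curvature_def curvature_field_def nabla_const
    by (simp add: nabla_def d christoffel_bcv F assms frechet_derivative_const)
qed

text \<open>In dimension three the curvature is an operator on bivectors, and the vector product identifies these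
  with vectors. In the frame \<open>E1, E2, E3\<close> it is diagonal, with entries the sectional curvatures
  \<open>l\<^sup>2/4, l\<^sup>2/4, 4 m - 3 l\<^sup>2/4\<close> of the planes orthogonal to \<open>E1, E2, E3\<close>.\<close>

definition bcv_curvature_op :: "real \<Rightarrow> real \<Rightarrow> real^3 \<Rightarrow> real^3" where
  "bcv_curvature_op m l w = (l^2/4) *\<^sub>R w + ((4 * m - l^2) * w$3) *\<^sub>R axis 3 1"

lemma bcv_components_curvature:
  assumes "p \<in> bcv_space m"
  shows "bcv_components m l p (curvature (bcv_metric m l) p u v w)
    = cross3 (bcv_components m l p w)
        (bcv_curvature_op m l (cross3 (bcv_components m l p u) (bcv_components m l p v)))"
proof -
  define G where "G = inverse (bcv_F m p)"
  define k where "k = l/2"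
  define x y where xy: "x = p$1" "y = p$2"
  define t where "t a = a$3 + k * (y * a$1 - x * a$2) * G" for a :: "real^3"
  have F: "bcv_F m p \<noteq> 0" using assms by (simp add: bcv_space_def)
  have FG: "m * G * (x^2 + y^2) - (1 - G) = 0"
    using F by (simp add: G_def bcv_F_def xy field_simps)
  have l: "l^2/4 = k^2" "l^2 = 4 * k^2" by (simp_all add: k_def power2_eq_square)
  let ?c = "bcv_components m l p"
  let ?\<Gamma> = "bcv_christoffel m l p"
  let ?d = "bcv_dchristoffel m l p"
  let ?K = "curvature (bcv_metric m l) p u v w"
  let ?R = "cross3 (?c w) (bcv_curvature_op m l (cross3 (?c u) (?c v)))"
  have c: "?c a $ 1 = a$1 * G" "?c a $ 2 = a$2 * G" "?c a $ 3 = t a" for a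
    unfolding bcv_components_nth[OF F] t_def G_def k_def[symmetric] xy unfolding divide_inverse
    by simp_all
  have \<Gamma>: "?\<Gamma> a b $ 1 = - 2 * m * G * (x * (a$1 * b$1 - a$2 * b$2) + y * (a$1 * b$2 + a$2 * b$1))
        + k * (a$2 * t b + b$2 * t a)"
    "?\<Gamma> a b $ 2 = - 2 * m * G * (y * (a$2 * b$2 - a$1 * b$1) + x * (a$1 * b$2 + a$2 * b$1))
        - k * (a$1 * t b + b$1 * t a)"
    "?\<Gamma> a b $ 3 = k * m * G^2 * (2 * x * y * (a$1 * b$1 - a$2 * b$2) + (y^2 - x^2) * (a$1 * b$2 + a$2 * b$1))
        - k^2 * G * ((x * a$1 + y * a$2) * t b + (x * b$1 + y * b$2) * t a)" for a b
    unfolding bcv_christoffel_def Let_def vector_3 l(1) t_def G_def k_def[symmetric] xy by (rule refl)+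
  \<comment> \<open>In the \<open>E3\<close>-component of the Christoffel term all contributions
    containing \<open>t a\<close> or \<open>t b\<close> cancel.\<close>
  have t\<Gamma>: "t (?\<Gamma> a b) = k * m * G^2 * ((x^2 - y^2) * (a$1 * b$2 + a$2 * b$1) - 2 * x * y * (a$1 * b$1 - a$2 * b$2))"
    for a b
    unfolding t_def[of "?\<Gamma> a b"] \<Gamma> by (simp add: algebra_simps power2_eq_square)
  define d1 where "d1 h = - 2 * m * (x * h$1 + y * h$2) * G^2" for h :: "real^3"
  define dt where "dt h a = k * ((h$2 * a$1 - h$1 * a$2) * G + (y * a$1 - x * a$2) * d1 h)" for h a :: "real^3"
  have d: "?d h a b $ 1 = - 2 * m * (d1 h * (x * (a$1 * b$1 - a$2 * b$2) + y * (a$1 * b$2 + a$2 * b$1))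
        + G * (h$1 * (a$1 * b$1 - a$2 * b$2) + h$2 * (a$1 * b$2 + a$2 * b$1))) + k * (a$2 * dt h b + b$2 * dt h a)"
    "?d h a b $ 2 = - 2 * m * (d1 h * (x * (a$1 * b$2 + a$2 * b$1) - y * (a$1 * b$1 - a$2 * b$2))
        + G * (h$1 * (a$1 * b$2 + a$2 * b$1) - h$2 * (a$1 * b$1 - a$2 * b$2))) - k * (a$1 * dt h b + b$1 * dt h a)"
    for h a b
    unfolding bcv_dchristoffel_def Let_def vector_3 t_def d1_def dt_def G_def k_def[symmetric] xy by (rule refl)+
  \<comment> \<open>Product rule: differentiating \<open>t (?\<Gamma> a b)\<close> in direction
    \<open>h\<close> gives \<open>t (?d h a b) + dt h (?\<Gamma> a b)\<close>, since the functional
    \<open>t\<close> itself varies with the point. The first group of terms is the derivative of the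
    right-hand side of \<open>t\<Gamma>\<close>.\<close>
  have td: "t (?d h a b) = k * m * (2 * G * d1 h * ((x^2 - y^2) * (a$1 * b$2 + a$2 * b$1) - 2 * x * y * (a$1 * b$1 - a$2 * b$2))
      + G^2 * (2 * (x * h$1 - y * h$2) * (a$1 * b$2 + a$2 * b$1) - 2 * (h$1 * y + x * h$2) * (a$1 * b$1 - a$2 * b$2)))
      - dt h (?\<Gamma> a b)" for h a b
  proof -
    have "?d h a b $ 3 = k * m * (2 * G * d1 h * (2 * x * y * (a$1 * b$1 - a$2 * b$2) + (y^2 - x^2) * (a$1 * b$2 + a$2 * b$1))
           + G^2 * (2 * (h$1 * y + x * h$2) * (a$1 * b$1 - a$2 * b$2) + 2 * (y * h$2 - x * h$1) * (a$1 * b$2 + a$2 * b$1)))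
         - k^2 * (d1 h * ((x * a$1 + y * a$2) * t b + (x * b$1 + y * b$2) * t a)
           + G * ((h$1 * a$1 + h$2 * a$2) * t b + (h$1 * b$1 + h$2 * b$2) * t a
              + (x * a$1 + y * a$2) * dt h b + (x * b$1 + y * b$2) * dt h a))"
      unfolding bcv_dchristoffel_def Let_def vector_3 l(1) t_def d1_def dt_def G_def k_def[symmetric] xy by (rule refl)
    then show ?thesis
      unfolding t_def[of "?d h a b"] d dt_def[of h "?\<Gamma> a b"] \<Gamma> by (simp add: algebra_simps power2_eq_square)
  qed
  have tadd: "t (a - b + a' - b') = t a - t b + t a' - t b'" for a b a' b'
    by (simp add: t_def algebra_simps)
  \<comment> \<open>Each component of the difference is an explicit multiple of \<open>?rel\<close>,
    which vanishes by \<open>FG\<close>.\<close>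
  let ?rel = "m * G * (x^2 + y^2) - (1 - G)"
  note unf = bcv_curvature[OF assms] bcv_curvature_op_def cross3_def vector_3
    vector_add_component vector_minus_component vector_scaleR_component c tadd td t\<Gamma> \<Gamma> d l
    dt_def d1_def
  have "?c ?K $ 1 - ?R $ 1 = (3 * k^2 - 4 * m) * G^2 * w$2 * (u$1 * v$2 - u$2 * v$1) * ?rel"
    unfolding unf by (simp add: axis_def) (simp add: algebra_simps power2_eq_square)
  moreover have "?c ?K $ 2 - ?R $ 2 = - (3 * k^2 - 4 * m) * G^2 * w$1 * (u$1 * v$2 - u$2 * v$1) * ?rel"
    unfolding unf by (simp add: axis_def) (simp add: algebra_simps power2_eq_square)
  moreover have "?c ?K $ 3 - ?R $ 3 = k^2 * G * (t v * (u$1 * w$1 + u$2 * w$2) - t u * (v$1 * w$1 + v$2 * w$2)) * ?rel"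
    unfolding unf by (simp add: axis_def) (simp add: algebra_simps power2_eq_square)
  ultimately show ?thesis
    by (simp add: FG vec_eq_iff forall_3)
qed

section \<open>Curves and their frame components\<close>

text \<open>Every point of a nondegenerate interval is a limit point of it; this makes derivatives
  within \<open>I\<close> unique, also at endpoints.\<close>

lemma at_within_interval_neq_bot:
  fixes I :: "real set"
  assumes "is_interval I" "a \<in> I" "b \<in> I" "a < b" "s \<in> I"
  shows "at s within I \<noteq> bot"
proof -
  have "I \<noteq> {t}" for t using assms by force
  then have "s islimpt I"
    using assms by (intro connected_imp_perfect is_interval_connected)
  then show ?thesis by (simp add: trivial_limit_within)
qed

lemma der_on_eqI:
  assumes "at s within I \<noteq> bot" "(f has_vector_derivative f') (at s within I)"
  shows "der_on I f s = f'"
  using assms by (simp add: der_on_def vector_derivative_within)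

text \<open>\<open>vector_derivative\<close> chooses from the derivative relation, and that relation
  is the same for both functions; hence the values agree even where no derivative exists.\<close>

lemma der_on_cong:
  assumes "\<And>t. t \<in> I \<Longrightarrow> f t = g t" "s \<in> I"
  shows "der_on I f s = der_on I g s"
proof -
  have "(f has_vector_derivative D) (at s within I) \<longleftrightarrow> (g has_vector_derivative D) (at s within I)" for D
    using assms has_vector_derivative_transform by metis
  then show ?thesis by (simp add: der_on_def vector_derivative_def)
qed

lemma smooth_on_interval_has_vector_derivative:
  assumes "smooth_on_interval I f" "s \<in> I"
  shows "(f has_vector_derivative der_on I f s) (at s within I)"
proof -
  have "f differentiable_on I"
    using assms(1)[unfolded smooth_on_interval_def, rule_format, of 0] by simp
  then show ?thesis
    using assms(2) by (simp add: der_on_def differentiable_on_def vector_derivative_works)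
qed

lemma smooth_on_interval_der_on:
  assumes "smooth_on_interval I f"
  shows "smooth_on_interval I (der_on I f)"
  using assms unfolding smooth_on_interval_def
  by (metis funpow_Suc_right o_apply)

lemma cov_deriv_cong:
  assumes "\<And>t. t \<in> I \<Longrightarrow> V t = W t" "s \<in> I"
  shows "cov_deriv g I \<gamma> V s = cov_deriv g I \<gamma> W s"
  using der_on_cong[of I V W s] assms by (simp add: cov_deriv_def)

text \<open>Constant coefficients suffice, since \<kappa> and \<tau> are constant along a
  helix.\<close>

lemma cov_deriv_linear:
  assumes "at s within I \<noteq> bot"
    and "(V has_vector_derivative V') (at s within I)" "(W has_vector_derivative W') (at s within I)"
  shows "cov_deriv g I \<gamma> (\<lambda>t. a *\<^sub>R V t + b *\<^sub>R W t) s
    = a *\<^sub>R cov_deriv g I \<gamma> V s + b *\<^sub>R cov_deriv g I \<gamma> W s"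
proof -
  have "((\<lambda>t. a *\<^sub>R V t + b *\<^sub>R W t) has_vector_derivative a *\<^sub>R V' + b *\<^sub>R W') (at s within I)"
    using assms(2,3)
    by (intro has_vector_derivative_add bounded_linear.has_vector_derivative[OF bounded_linear_scaleR_right])
  then show ?thesis
    using assms
    by (simp add: cov_deriv_def der_on_eqI christoffel_add_right christoffel_scaleR_right scaleR_add_right)
qed

lemma nabla_T_pow_Suc: "nabla_T_pow g I \<gamma> (Suc k) = cov_deriv g I \<gamma> (nabla_T_pow g I \<gamma> k)"
  by (simp add: nabla_T_pow_def)

text \<open>The Frenet equations give -(\<kappa>^2 + \<tau>^2) N as the covariant derivative of
  \<tau> B - \<kappa> T, so two differentiations multiply N by -(\<kappa>^2 + \<tau>^2). The even
  orders start at 2, because T itself is not a multiple of \<tau> B - \<kappa> T.\<close>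

lemma nabla_T_pow_helix:
  assumes nb: "\<And>s. s \<in> I \<Longrightarrow> at s within I \<noteq> bot"
    and smooth: "smooth_on_interval I \<gamma>" "smooth_on_interval I N" "smooth_on_interval I B"
    and T: "\<And>s. s \<in> I \<Longrightarrow> cov_deriv g I \<gamma> (der_on I \<gamma>) s = \<kappa> *\<^sub>R N s"
    and N: "\<And>s. s \<in> I \<Longrightarrow> cov_deriv g I \<gamma> N s = - \<kappa> *\<^sub>R der_on I \<gamma> s + \<tau> *\<^sub>R B s"
    and B: "\<And>s. s \<in> I \<Longrightarrow> cov_deriv g I \<gamma> B s = - \<tau> *\<^sub>R N s"
    and "s \<in> I"
  shows "nabla_T_pow g I \<gamma> (2 * k + 1) s = ((- (\<kappa>^2 + \<tau>^2))^k * \<kappa>) *\<^sub>R N s"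
    and "nabla_T_pow g I \<gamma> (2 * k + 2) s
      = ((- (\<kappa>^2 + \<tau>^2))^k * \<kappa>) *\<^sub>R (\<tau> *\<^sub>R B s - \<kappa> *\<^sub>R der_on I \<gamma> s)"
proof -
  note T' = smooth_on_interval_has_vector_derivative[OF smooth_on_interval_der_on[OF smooth(1)]]
  note N' = smooth_on_interval_has_vector_derivative[OF smooth(2)]
  note B' = smooth_on_interval_has_vector_derivative[OF smooth(3)]
  let ?c = "\<lambda>k. (- (\<kappa>^2 + \<tau>^2))^k * \<kappa>"
  have even: "nabla_T_pow g I \<gamma> (2 * k + 2) t = ?c k *\<^sub>R (\<tau> *\<^sub>R B t - \<kappa> *\<^sub>R der_on I \<gamma> t)"
    if odd: "\<And>t. t \<in> I \<Longrightarrow> nabla_T_pow g I \<gamma> (2 * k + 1) t = ?c k *\<^sub>R N t" and t: "t \<in> I" for k t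
  proof -
    have "nabla_T_pow g I \<gamma> (2 * k + 2) t = cov_deriv g I \<gamma> (nabla_T_pow g I \<gamma> (2 * k + 1)) t"
      using nabla_T_pow_Suc[of g I \<gamma> "2 * k + 1"] by simp
    \<comment> \<open>The zero summand gives the field the two-term shape of
      \<open>cov_deriv_linear\<close>.\<close>
    also have "\<dots> = cov_deriv g I \<gamma> (\<lambda>t. ?c k *\<^sub>R N t + 0 *\<^sub>R N t) t"
      using odd t by (intro cov_deriv_cong) auto
    also have "\<dots> = ?c k *\<^sub>R (\<tau> *\<^sub>R B t - \<kappa> *\<^sub>R der_on I \<gamma> t)"
      using cov_deriv_linear[OF nb[OF t] N'[OF t] N'[OF t], of g \<gamma> "?c k" 0]
      by (simp only: N[OF t]) simp
    finally show ?thesis .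
  qed
  have odd: "nabla_T_pow g I \<gamma> (2 * k + 1) t = ?c k *\<^sub>R N t" if "t \<in> I" for k t
    using that
  proof (induction k arbitrary: t)
    case 0
    then show ?case by (simp add: nabla_T_pow_def T)
  next
    case (Suc k)
    have "nabla_T_pow g I \<gamma> (2 * Suc k + 1) t = cov_deriv g I \<gamma> (nabla_T_pow g I \<gamma> (2 * k + 2)) t"
      using nabla_T_pow_Suc[of g I \<gamma> "2 * k + 2"] by (simp add: numeral_2_eq_2)
    also have "\<dots> = cov_deriv g I \<gamma> (\<lambda>t. (?c k * \<tau>) *\<^sub>R B t + (- ?c k * \<kappa>) *\<^sub>R der_on I \<gamma> t) t"
      using even[OF Suc.IH] Suc.prems by (intro cov_deriv_cong) (auto simp: scaleR_diff_right)
    also have "\<dots> = (?c k * \<tau>) *\<^sub>R (- \<tau> *\<^sub>R N t) + (- ?c k * \<kappa>) *\<^sub>R (\<kappa> *\<^sub>R N t)"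
      using cov_deriv_linear[OF nb[OF Suc.prems] B'[OF Suc.prems] T'[OF Suc.prems]] Suc.prems
      by (simp only: B T)
    also have "\<dots> = ?c (Suc k) *\<^sub>R N t"
      by (simp add: algebra_simps power2_eq_square flip: scaleR_add_left)
    finally show ?case .
  qed
  show "nabla_T_pow g I \<gamma> (2 * k + 1) s = ?c k *\<^sub>R N s"
    using odd \<open>s \<in> I\<close> .
  show "nabla_T_pow g I \<gamma> (2 * k + 2) s = ?c k *\<^sub>R (\<tau> *\<^sub>R B s - \<kappa> *\<^sub>R der_on I \<gamma> s)"
    using even[OF odd \<open>s \<in> I\<close>] .
qed

lemma has_vector_derivative_vec_nth:
  assumes "(V has_vector_derivative V') F"
  shows "((\<lambda>t. V t $ i) has_vector_derivative V' $ i) F"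
  by (rule bounded_linear.has_vector_derivative[OF bounded_linear_vec_nth assms])

text \<open>The frame turns along the curve, so derivatives of components differ from components of
  the covariant derivative by a skew-symmetric matrix applied to \<open>X\<close>. Here
  \<open>\<phi>\<close> comes from the conformal factor of the base and the terms with
  \<open>l/2\<close> from the fibration.\<close>

lemma bcv_components_has_real_derivative:
  fixes l :: real
  assumes nb: "at s within I \<noteq> bot" and s: "s \<in> I"
    and sub: "\<gamma> ` I \<subseteq> bcv_space m"
    and \<gamma>: "(\<gamma> has_vector_derivative \<gamma>') (at s within I)"
    and V: "(V has_vector_derivative V') (at s within I)"
  defines "T \<equiv> bcv_components m l (\<gamma> s) \<gamma>'"
    and "X \<equiv> bcv_components m l (\<gamma> s) (V s)"
    and "Z \<equiv> bcv_components m l (\<gamma> s) (cov_deriv (bcv_metric m l) I \<gamma> V s)"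
    and "\<phi> \<equiv> 2 * m * (\<gamma> s $ 2 * bcv_components m l (\<gamma> s) \<gamma>' $ 1 - \<gamma> s $ 1 * bcv_components m l (\<gamma> s) \<gamma>' $ 2)"
  shows "((\<lambda>t. bcv_components m l (\<gamma> t) (V t) $ 1) has_real_derivative
      Z$1 + \<phi> * X$2 - l/2 * (T$2 * X$3 + T$3 * X$2)) (at s within I)"
    and "((\<lambda>t. bcv_components m l (\<gamma> t) (V t) $ 2) has_real_derivative
      Z$2 - \<phi> * X$1 + l/2 * (T$1 * X$3 + T$3 * X$1)) (at s within I)"
    and "((\<lambda>t. bcv_components m l (\<gamma> t) (V t) $ 3) has_real_derivative
      Z$3 - l/2 * (T$1 * X$2 - T$2 * X$1)) (at s within I)"
proof -
  define G where "G t = inverse (bcv_F m (\<gamma> t))" for t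
  define k where "k = l/2"
  have l2: "l^2/4 = k^2" by (simp add: k_def power2_eq_square)
  define x y where xy: "x = \<gamma> s $ 1" "y = \<gamma> s $ 2"
  define g where "g = G s"
  define x' y' where xy': "x' = \<gamma>' $ 1" "y' = \<gamma>' $ 2"
  have F: "bcv_F m (\<gamma> t) \<noteq> 0" if "t \<in> I" for t
    using sub that by (auto simp: bcv_space_def)
  have FG: "m * g * (x^2 + y^2) - (1 - g) = 0"
    using F[OF s] by (simp add: g_def G_def bcv_F_def xy field_simps)
  have d\<gamma>: "((\<lambda>t. \<gamma> t $ i) has_real_derivative \<gamma>' $ i) (at s within I)" for i
    using has_vector_derivative_vec_nth[OF \<gamma>] by (simp add: has_real_derivative_iff_has_vector_derivative)
  have dV: "((\<lambda>t. V t $ i) has_real_derivative V' $ i) (at s within I)" for i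
    using has_vector_derivative_vec_nth[OF V] by (simp add: has_real_derivative_iff_has_vector_derivative)
  define dg where "dg = - 2 * m * (x * x' + y * y') * g^2"
  have dG: "(G has_real_derivative dg) (at s within I)"
    unfolding G_def[abs_def] bcv_F_def
    by (rule derivative_eq_intros d\<gamma> refl)+
      (use F[OF s] in \<open>simp_all add: bcv_F_def dg_def g_def G_def xy xy' power2_eq_square algebra_simps\<close>)
  have c: "bcv_components m l (\<gamma> t) a $ 1 = a$1 * G t" "bcv_components m l (\<gamma> t) a $ 2 = a$2 * G t"
    "bcv_components m l (\<gamma> t) a $ 3 = a$3 + k * (\<gamma> t $ 2 * a$1 - \<gamma> t $ 1 * a$2) * G t" if "t \<in> I" for t a
    unfolding bcv_components_nth[OF F[OF that]] k_def[symmetric] G_def unfolding divide_inverse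
    by simp_all
  have cov: "cov_deriv (bcv_metric m l) I \<gamma> V s = V' + bcv_christoffel m l (\<gamma> s) \<gamma>' (V s)"
    by (simp add: cov_deriv_def der_on_eqI[OF nb \<gamma>] der_on_eqI[OF nb V] christoffel_bcv F s)
  note unf = T_def X_def Z_def \<phi>_def c[OF s] cov bcv_christoffel_def Let_def vector_3 vector_add_component
    l2 k_def[symmetric] G_def[of s, symmetric] g_def[symmetric] xy[symmetric] xy'[symmetric]
  have e1: "V' $ 1 * g + V s $ 1 * dg = Z$1 + \<phi> * X$2 - l/2 * (T$2 * X$3 + T$3 * X$2)"
    unfolding unf dg_def by (simp add: algebra_simps power2_eq_square)
  have e2: "V' $ 2 * g + V s $ 2 * dg = Z$2 - \<phi> * X$1 + l/2 * (T$1 * X$3 + T$3 * X$1)"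
    unfolding unf dg_def by (simp add: algebra_simps power2_eq_square)
  \<comment> \<open>Unlike \<open>e1\<close> and \<open>e2\<close>, this identity is proved modulo
    the relation between F and its inverse, with the cofactor displayed.\<close>
  have e3: "V' $ 3 + k * ((y' * V s $ 1 + y * V' $ 1 - (x' * V s $ 2 + x * V' $ 2)) * g + (y * V s $ 1 - x * V s $ 2) * dg)
      - (Z$3 - l/2 * (T$1 * X$2 - T$2 * X$1))
    = - (k * g * (y' * V s $ 1 - x' * V s $ 2)) * (m * g * (x^2 + y^2) - (1 - g))"
    unfolding unf dg_def by (simp add: algebra_simps power2_eq_square)
  show "((\<lambda>t. bcv_components m l (\<gamma> t) (V t) $ 1) has_real_derivative
      Z$1 + \<phi> * X$2 - l/2 * (T$2 * X$3 + T$3 * X$2)) (at s within I)"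
    unfolding e1[symmetric] g_def
    by (rule has_field_derivative_transform_within[where d=1, OF _ _ s])
      (auto intro!: derivative_eq_intros dV dG simp: c)
  show "((\<lambda>t. bcv_components m l (\<gamma> t) (V t) $ 2) has_real_derivative
      Z$2 - \<phi> * X$1 + l/2 * (T$1 * X$3 + T$3 * X$1)) (at s within I)"
    unfolding e2[symmetric] g_def
    by (rule has_field_derivative_transform_within[where d=1, OF _ _ s])
      (auto intro!: derivative_eq_intros dV dG simp: c)
  have "((\<lambda>t. V t $ 3 + k * (\<gamma> t $ 2 * V t $ 1 - \<gamma> t $ 1 * V t $ 2) * G t) has_real_derivative
      Z$3 - l/2 * (T$1 * X$2 - T$2 * X$1)) (at s within I)"
  proof -
    have "((\<lambda>t. V t $ 3 + k * (\<gamma> t $ 2 * V t $ 1 - \<gamma> t $ 1 * V t $ 2) * G t) has_real_derivative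
      V' $ 3 + k * ((y' * V s $ 1 + y * V' $ 1 - (x' * V s $ 2 + x * V' $ 2)) * g + (y * V s $ 1 - x * V s $ 2) * dg))
      (at s within I)"
      by (rule derivative_eq_intros dV dG d\<gamma> refl)+ (simp add: xy xy' g_def algebra_simps)
    then show ?thesis using e3 by (simp add: FG)
  qed
  then show "((\<lambda>t. bcv_components m l (\<gamma> t) (V t) $ 3) has_real_derivative
      Z$3 - l/2 * (T$1 * X$2 - T$2 * X$1)) (at s within I)"
    by (rule has_field_derivative_transform_within[where d=1, OF _ _ s]) (auto simp: c)
qed

section \<open>Helices\<close>

lemma linear_bcv_curvature_op: "linear (bcv_curvature_op m l)"
  by (rule linearI) (simp_all add: bcv_curvature_op_def vec_eq_iff algebra_simps)

lemma linear_cross3_right: "linear (cross3 u)"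
  by (rule linearI) (simp_all add: cross_add_right cross_mult_right)

text \<open>The last identity follows from t = n x b and the triple product rule. For e =
  \<open>E3\<close> it gives T \<and> E3 = N3 B - B3 N, the source of both N3 and B3 in the tension
  field.\<close>

lemma cross3_orthonormal:
  assumes "t \<bullet> t = 1" "n \<bullet> n = 1" "t \<bullet> n = 0" "b = cross3 t n"
  shows "cross3 n b = t" "cross3 t b = - n" "b \<bullet> b = 1" "t \<bullet> b = 0" "n \<bullet> b = 0"
    and "cross3 t e = (n \<bullet> e) *\<^sub>R b - (b \<bullet> e) *\<^sub>R n"
proof -
  have tri: "cross3 u (cross3 v w) = (u \<bullet> w) *\<^sub>R v - (u \<bullet> v) *\<^sub>R w" for u v w
    by (simp add: cross3_def inner_3 vec_eq_iff forall_3 algebra_simps)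
  have tri': "cross3 (cross3 v w) u = (u \<bullet> v) *\<^sub>R w - (u \<bullet> w) *\<^sub>R v" for u v w
    by (simp add: cross3_def inner_3 vec_eq_iff forall_3 algebra_simps)
  show 1: "cross3 n b = t" and "cross3 t b = - n"
    using assms by (simp_all add: tri inner_commute)
  show "cross3 t e = (n \<bullet> e) *\<^sub>R b - (b \<bullet> e) *\<^sub>R n"
    unfolding 1[symmetric] tri' by (simp add: inner_commute)
  show "b \<bullet> b = 1" "t \<bullet> b = 0" "n \<bullet> b = 0"
    using assms 1 cross_triple[of t n b] by (simp_all add: dot_cross_self)
qed

text \<open>A locale, so that all facts about a helix can be instantiated a second time for the
  reversed curve.\<close>

locale bcv_helix =
  fixes m l :: real and I :: "real set" and \<gamma> N B :: "real \<Rightarrow> real^3" and \<kappa> \<tau> :: real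
  assumes frame: "frenet_helix_frame m l I \<gamma> N B \<kappa> \<tau>"
begin

definition t :: "real \<Rightarrow> real^3" where "t s = bcv_components m l (\<gamma> s) (der_on I \<gamma> s)"
definition n :: "real \<Rightarrow> real^3" where "n s = bcv_components m l (\<gamma> s) (N s)"
definition b :: "real \<Rightarrow> real^3" where "b s = bcv_components m l (\<gamma> s) (B s)"

lemma
  shows interval: "is_interval I" and nontrivial: "\<exists>a\<in>I. \<exists>b\<in>I. a < b"
    and smooth: "smooth_on_interval I \<gamma>" "smooth_on_interval I N" "smooth_on_interval I B"
    and sub: "\<gamma> ` I \<subseteq> bcv_space m" and kappa_pos: "\<kappa> > 0"
  using frame by (auto simp: frenet_helix_frame_def arc_length_curve_def)

lemma neq_bot: "s \<in> I \<Longrightarrow> at s within I \<noteq> bot"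
  using interval nontrivial at_within_interval_neq_bot by metis

lemma in_bcv_space: "s \<in> I \<Longrightarrow> \<gamma> s \<in> bcv_space m"
  using sub by auto

lemma bcv_F_neq_0: "s \<in> I \<Longrightarrow> bcv_F m (\<gamma> s) \<noteq> 0"
  using in_bcv_space[of s] by (simp add: bcv_space_def)

lemma frenet:
  assumes "s \<in> I"
  shows "cov_deriv (bcv_metric m l) I \<gamma> (der_on I \<gamma>) s = \<kappa> *\<^sub>R N s"
    and "cov_deriv (bcv_metric m l) I \<gamma> N s = - \<kappa> *\<^sub>R der_on I \<gamma> s + \<tau> *\<^sub>R B s"
    and "cov_deriv (bcv_metric m l) I \<gamma> B s = - \<tau> *\<^sub>R N s"
  using frame assms by (auto simp: frenet_helix_frame_def)

lemma orthonormal: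
  assumes "s \<in> I"
  shows "t s \<bullet> t s = 1" "n s \<bullet> n s = 1" "t s \<bullet> n s = 0" "b s = cross3 (t s) (n s)"
  using frame assms
  by (auto simp: frenet_helix_frame_def arc_length_curve_def t_def n_def b_def bcv_metric_eq_inner bcv_F_neq_0
      bcv_components_wedge)

lemma b_nth: "s \<in> I \<Longrightarrow> b s $ 1 = t s $ 2 * n s $ 3 - t s $ 3 * n s $ 2"
  "s \<in> I \<Longrightarrow> b s $ 2 = t s $ 3 * n s $ 1 - t s $ 1 * n s $ 3"
  "s \<in> I \<Longrightarrow> b s $ 3 = t s $ 1 * n s $ 2 - t s $ 2 * n s $ 1"
  by (simp_all add: orthonormal cross3_def)

lemma linear_components: "s \<in> I \<Longrightarrow> linear (bcv_components m l (\<gamma> s))"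
  by (rule linear_bcv_components[OF bcv_F_neq_0])

definition phi :: "real \<Rightarrow> real" where
  "phi s = 2 * m * (\<gamma> s $ 2 * t s $ 1 - \<gamma> s $ 1 * t s $ 2)"

lemma deriv_t:
  assumes "s \<in> I"
  shows "((\<lambda>s. t s $ 1) has_real_derivative \<kappa> * n s $ 1 + (phi s - l * t s $ 3) * t s $ 2) (at s within I)"
    and "((\<lambda>s. t s $ 2) has_real_derivative \<kappa> * n s $ 2 - (phi s - l * t s $ 3) * t s $ 1) (at s within I)"
    and "((\<lambda>s. t s $ 3) has_real_derivative \<kappa> * n s $ 3) (at s within I)"
  using bcv_components_has_real_derivative[OF neq_bot[OF assms] assms sub
      smooth_on_interval_has_vector_derivative[OF smooth(1) assms]
      smooth_on_interval_has_vector_derivative[OF smooth_on_interval_der_on[OF smooth(1)] assms], of l]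
  by (simp_all add: frenet[OF assms] linear_scale[OF linear_components[OF assms]] phi_def algebra_simps
      flip: t_def n_def)

lemma deriv_n_3:
  assumes "s \<in> I"
  shows "((\<lambda>s. n s $ 3) has_real_derivative - \<kappa> * t s $ 3 + (\<tau> - l/2) * b s $ 3) (at s within I)"
  using bcv_components_has_real_derivative(3)[OF neq_bot[OF assms] assms sub
      smooth_on_interval_has_vector_derivative[OF smooth(1) assms]
      smooth_on_interval_has_vector_derivative[OF smooth(2) assms], of l]
  by (simp add: frenet[OF assms] linear_scale[OF linear_components[OF assms]]
      linear_add[OF linear_components[OF assms]] linear_diff[OF linear_components[OF assms]] linear_neg[OF linear_components[OF assms]]
      b_nth[OF assms] left_diff_distrib algebra_simps flip: t_def n_def b_def)

lemma deriv_b_3: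
  assumes "s \<in> I"
  shows "((\<lambda>s. b s $ 3) has_real_derivative (l/2 - \<tau>) * n s $ 3) (at s within I)"
proof -
  have "t s $ 1 * b s $ 2 - t s $ 2 * b s $ 1 = - n s $ 3"
    using cross3_orthonormal(2)[OF orthonormal[OF assms]] by (simp add: cross3_def vec_eq_iff forall_3)
  then show ?thesis
    using bcv_components_has_real_derivative(3)[OF neq_bot[OF assms] assms sub
      smooth_on_interval_has_vector_derivative[OF smooth(1) assms]
      smooth_on_interval_has_vector_derivative[OF smooth(3) assms], of l]
    by (simp add: frenet[OF assms] linear_scale[OF linear_components[OF assms]]
      linear_neg[OF linear_components[OF assms]] left_diff_distrib flip: t_def n_def b_def)
qed

text \<open>The third component of the vector \<open>V\<close> for which the tension field is, up to a nonzero factor,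
  \<open>(\<kappa>\<^sup>2 + \<tau>\<^sup>2)\<^sup>2 N + T \<and> S V\<close>, where \<open>S\<close> is the curvature operator.\<close>

definition height :: "nat \<Rightarrow> real \<Rightarrow> real" where
  "height r s = (\<kappa>^2 + \<tau>^2 + (real r - 2) * \<kappa>^2) * b s $ 3 + (real r - 2) * \<kappa> * \<tau> * t s $ 3"

text \<open>With p = -(\<kappa>^2 + \<tau>^2), the curvature summands with j > 0 carry the power
  p^(r - 3). Multiplying by p raises it to p^(r - 2), which also makes sense for r = 2, where there
  are no such summands.\<close>

lemma r_tension_components:
  assumes s: "s \<in> I" and r: "r \<ge> 2"
  shows "- (\<kappa>^2 + \<tau>^2) *\<^sub>R bcv_components m l (\<gamma> s) (r_tension (bcv_metric m l) r I \<gamma> s)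
    = ((- (\<kappa>^2 + \<tau>^2))^(r - 2) * \<kappa>) *\<^sub>R
      (((\<kappa>^2 + \<tau>^2)^2 - l^2/4 * (\<kappa>^2 + \<tau>^2 + (real r - 2) * \<kappa>^2)
          - (4 * m - l^2) * height r s * b s $ 3) *\<^sub>R n s
       + ((4 * m - l^2) * height r s * n s $ 3) *\<^sub>R b s)"
proof -
  obtain q where q: "r = q + 2" using r le_Suc_ex by (metis add.commute)
  define p where "p = - (\<kappa>^2 + \<tau>^2)"
  let ?c = "bcv_components m l (\<gamma> s)"
  let ?nab = "\<lambda>k. nabla_T_pow (bcv_metric m l) I \<gamma> k s"
  define K where "K w = cross3 (t s) (bcv_curvature_op m l w)" for w
  define X where "X k = ?c (?nab k)" for k
  note lc = linear_components[OF s]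
  have lK: "linear K"
    unfolding K_def[abs_def]
    using linear_compose[OF linear_bcv_curvature_op linear_cross3_right] by (simp add: o_def)
  note co = cross3_orthonormal[OF orthonormal[OF s]]
  have X0: "X 0 = t s" by (simp add: X_def nabla_T_pow_def t_def)
  have X1: "X (2 * k + 1) = (p^k * \<kappa>) *\<^sub>R n s" for k
    using nabla_T_pow_helix(1)[OF neq_bot smooth frenet s, of k]
    by (simp only: X_def p_def linear_scale[OF lc] n_def)
  have X2: "X (2 * k + 2) = (p^k * \<kappa>) *\<^sub>R (\<tau> *\<^sub>R b s - \<kappa> *\<^sub>R t s)" for k
    using nabla_T_pow_helix(2)[OF neq_bot smooth frenet s, of k]
    by (simp only: X_def p_def linear_scale[OF lc] linear_diff[OF lc] n_def b_def t_def)
  have nX: "cross3 (n s) (\<tau> *\<^sub>R b s - \<kappa> *\<^sub>R t s) = \<tau> *\<^sub>R t s + \<kappa> *\<^sub>R b s"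
    using co(1) orthonormal(4)[OF s] cross_skew[of "n s" "t s"]
    by (simp add: linear_diff[OF linear_cross3_right] linear_scale[OF linear_cross3_right])
  \<comment> \<open>One of the two derivatives has odd order and is a multiple of N, the other is a
    multiple of \<tau> B - \<kappa> T. The parity of \<open>j\<close> decides which comes first, and
    (-1)^j undoes the resulting sign. The powers of \<open>p\<close> add up to \<open>q - 1\<close>
    for every \<open>j\<close>.\<close>
  have summand: "p *\<^sub>R ((-1)^j *\<^sub>R K (cross3 (X (2 * r - 3 - j)) (X j)))
      = (p^q * \<kappa>^2) *\<^sub>R K (\<tau> *\<^sub>R t s + \<kappa> *\<^sub>R b s)" if j: "j \<in> {1..q}" for j
  proof (cases "even j")
    case True
    then obtain a where "j = 2 * a" by blast
    with j obtain a where a: "j = 2 * a + 2"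
      by (cases a) auto
    then have "a + 1 \<le> q" using j by auto
    then obtain c where c: "q = c + a + 1"
      by (metis add.assoc add.commute le_Suc_ex)
    have "2 * r - 3 - j = 2 * c + 1" using q c a by simp
    then have "cross3 (X (2 * r - 3 - j)) (X j)
        = (p^c * \<kappa> * (p^a * \<kappa>)) *\<^sub>R (\<tau> *\<^sub>R t s + \<kappa> *\<^sub>R b s)"
      unfolding a by (simp only: X1 X2 cross_mult_left cross_mult_right nX scaleR_scaleR)
        (simp add: mult_ac)
    then show ?thesis
      using True by (simp add: linear_scale[OF lK] c power_add power2_eq_square mult_ac)
  next
    case False
    then obtain a where a: "j = 2 * a + 1" using oddE by blast
    then have "a + 1 \<le> q" using j by auto
    then obtain c where c: "q = c + a + 1"
      by (metis add.assoc add.commute le_Suc_ex)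
    have "2 * r - 3 - j = 2 * c + 2" using q c a by simp
    then have "cross3 (X (2 * r - 3 - j)) (X j)
        = - ((p^c * \<kappa> * (p^a * \<kappa>)) *\<^sub>R (\<tau> *\<^sub>R t s + \<kappa> *\<^sub>R b s))"
      unfolding a
      by (subst cross_skew, simp only: X1 X2 cross_mult_left cross_mult_right nX scaleR_scaleR)
    then show ?thesis
      using False by (simp add: linear_scale[OF lK] linear_neg[OF lK] c power_add power2_eq_square mult_ac)
  qed
  \<comment> \<open>The operator S splits into \<open>l^2/4\<close> times the identity and a
    multiple of the projection to \<open>E3\<close>. The former contributes T \<and> T = 0 and T
    \<and> B = - N, the latter a multiple of T \<and> E3.\<close>
  have KV: "K (u *\<^sub>R b s + v *\<^sub>R t s)
      = - (l^2/4 * u) *\<^sub>R n s + ((4 * m - l^2) * (u * b s $ 3 + v * t s $ 3)) *\<^sub>R (n s $ 3 *\<^sub>R b s - b s $ 3 *\<^sub>R n s)"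
    for u v
  proof -
    have "cross3 (t s) (axis 3 1) = n s $ 3 *\<^sub>R b s - b s $ 3 *\<^sub>R n s"
      using co(6)[of "axis 3 1"] by (simp add: inner_axis)
    then show ?thesis
      unfolding K_def bcv_curvature_op_def
      by (simp add: linear_add[OF linear_cross3_right] linear_scale[OF linear_cross3_right] co(2)
          cross_refl scaleR_add_right)
  qed
  have "?c (r_tension (bcv_metric m l) r I \<gamma> s)
      = X (2 * r - 1) + (\<Sum>j=0..r-2. (-1)^j *\<^sub>R K (cross3 (X (2 * r - 3 - j)) (X j)))"
    unfolding r_tension_def X_def K_def t_def
    by (simp add: linear_add[OF lc] linear_sum[OF lc] linear_scale[OF lc]
        bcv_components_curvature[OF in_bcv_space[OF s]])
  also have "2 * r - 1 = 2 * (q + 1) + 1" using q by simp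
  \<comment> \<open>The summand \<open>j = 0\<close> is separate: it contains T itself, which does
    not follow the alternating pattern.\<close>
  also have "{0..r-2} = insert 0 {1..q}" using q by auto
  also have "(\<Sum>j\<in>insert 0 {1..q}. (-1)^j *\<^sub>R K (cross3 (X (2 * r - 3 - j)) (X j)))
      = K (cross3 (X (2 * q + 1)) (X 0)) + (\<Sum>j\<in>{1..q}. (-1)^j *\<^sub>R K (cross3 (X (2 * r - 3 - j)) (X j)))"
    using q by simp
  finally have "p *\<^sub>R ?c (r_tension (bcv_metric m l) r I \<gamma> s)
      = p *\<^sub>R X (2 * (q + 1) + 1) + p *\<^sub>R K (cross3 (X (2 * q + 1)) (X 0))
        + (\<Sum>j\<in>{1..q}. p *\<^sub>R ((-1)^j *\<^sub>R K (cross3 (X (2 * r - 3 - j)) (X j))))"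
    by (simp only: scaleR_add_right scaleR_sum_right add.assoc)
  also have "(\<Sum>j\<in>{1..q}. p *\<^sub>R ((-1)^j *\<^sub>R K (cross3 (X (2 * r - 3 - j)) (X j))))
      = real q *\<^sub>R (p^q * \<kappa>^2) *\<^sub>R K (\<tau> *\<^sub>R t s + \<kappa> *\<^sub>R b s)"
    by (subst sum.cong[OF refl summand], assumption, simp add: sum_constant_scaleR del: sum_constant)
  also have "cross3 (X (2 * q + 1)) (X 0) = - (p^q * \<kappa>) *\<^sub>R b s"
    unfolding X0 X1 cross_mult_left orthonormal(4)[OF s] using cross_skew[of "n s" "t s"] by simp
  also have "p *\<^sub>R X (2 * (q + 1) + 1) + p *\<^sub>R K (- (p^q * \<kappa>) *\<^sub>R b s)
        + real q *\<^sub>R (p^q * \<kappa>^2) *\<^sub>R K (\<tau> *\<^sub>R t s + \<kappa> *\<^sub>R b s)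
      = (p^q * \<kappa>) *\<^sub>R (p^2 *\<^sub>R n s + K ((- p + real q * \<kappa>^2) *\<^sub>R b s + (real q * \<kappa> * \<tau>) *\<^sub>R t s))"
    unfolding X1
    by (simp add: linear_add[OF lK] linear_scale[OF lK] linear_neg[OF lK] linear_diff[OF lK]
        algebra_simps power2_eq_square)
  also have "\<dots> = (p^q * \<kappa>) *\<^sub>R
      (((\<kappa>^2 + \<tau>^2)^2 - l^2/4 * (\<kappa>^2 + \<tau>^2 + (real r - 2) * \<kappa>^2)
          - (4 * m - l^2) * height r s * b s $ 3) *\<^sub>R n s
       + ((4 * m - l^2) * height r s * n s $ 3) *\<^sub>R b s)"
  proof -
    have "- p + real q * \<kappa>^2 = \<kappa>^2 + \<tau>^2 + (real r - 2) * \<kappa>^2" "real q = real r - 2"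
      by (simp_all add: p_def q)
    moreover have "p^2 = (\<kappa>^2 + \<tau>^2)^2"
      unfolding p_def by (rule power2_minus)
    ultimately show ?thesis
      unfolding KV height_def by (simp add: scaleR_diff_right scaleR_diff_left mult_ac)
  qed
  finally show ?thesis by (simp add: p_def q)
qed

lemma r_tension_eq_0_iff:
  assumes s: "s \<in> I" and r: "r \<ge> 2"
  shows "r_tension (bcv_metric m l) r I \<gamma> s = 0 \<longleftrightarrow>
    (\<kappa>^2 + \<tau>^2)^2 - l^2/4 * (\<kappa>^2 + \<tau>^2 + (real r - 2) * \<kappa>^2) - (4 * m - l^2) * height r s * b s $ 3 = 0
    \<and> (4 * m - l^2) * height r s * n s $ 3 = 0"
proof -
  have pos: "\<kappa>^2 + \<tau>^2 > 0" using kappa_pos by (simp add: add_pos_nonneg)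
  have indep: "u *\<^sub>R n s + v *\<^sub>R b s = 0 \<longleftrightarrow> u = 0 \<and> v = 0" for u v
  proof
    assume *: "u *\<^sub>R n s + v *\<^sub>R b s = 0"
    have "u = n s \<bullet> (u *\<^sub>R n s + v *\<^sub>R b s)" "v = b s \<bullet> (u *\<^sub>R n s + v *\<^sub>R b s)"
      using cross3_orthonormal[OF orthonormal[OF s]] orthonormal(2)[OF s]
      by (simp_all add: inner_add_right inner_commute)
    then show "u = 0 \<and> v = 0" unfolding * by simp
  qed simp
  have "r_tension (bcv_metric m l) r I \<gamma> s = 0
      \<longleftrightarrow> - (\<kappa>^2 + \<tau>^2) *\<^sub>R bcv_components m l (\<gamma> s) (r_tension (bcv_metric m l) r I \<gamma> s) = 0"
    using pos by (simp add: bcv_components_eq_0_iff[OF bcv_F_neq_0[OF s]])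
  then show ?thesis
    unfolding r_tension_components[OF s r] scaleR_eq_0_iff indep
    using pos kappa_pos by auto
qed

lemma r_harmonic_imp_n_3_eq_0:
  assumes "4 * m \<noteq> l^2" "r \<ge> 2" "r_harmonic (bcv_metric m l) r I \<gamma>" "s \<in> I"
  shows "n s $ 3 = 0"
proof (rule ccontr)
  assume n0: "n s $ 3 \<noteq> 0"
  note eqs = r_tension_eq_0_iff[OF _ assms(2), THEN iffD1, OF _ assms(3)[unfolded r_harmonic_def, rule_format]]
  define A where "A = \<kappa>^2 + \<tau>^2 + (real r - 2) * \<kappa>^2"
  \<comment> \<open>N3 stays nonzero near \<open>s\<close>, so \<open>height r\<close> vanishes on a
    whole neighbourhood and can be differentiated there.\<close>
  have "continuous (at s within I) (\<lambda>s. n s $ 3)"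
    using deriv_n_3[OF \<open>s \<in> I\<close>] by (rule DERIV_continuous)
  then obtain d where "d > 0" and d: "\<And>u. u \<in> I \<Longrightarrow> dist s u < d \<Longrightarrow> n u $ 3 \<noteq> 0"
    using continuous_within_avoid[of s I "\<lambda>s. n s $ 3" 0] n0 by blast
  have h0: "height r u = 0" if "u \<in> I" "dist s u < d" for u
    using eqs[OF that(1) that(1)] d[OF that] assms(1) by simp
  have "(height r has_real_derivative A * ((l/2 - \<tau>) * n s $ 3) + (real r - 2) * \<kappa> * \<tau> * (\<kappa> * n s $ 3)) (at s within I)"
    unfolding height_def[abs_def] A_def
    by (intro DERIV_add DERIV_cmult deriv_b_3 deriv_t \<open>s \<in> I\<close>)
  moreover have "(height r has_real_derivative 0) (at s within I)"
    by (rule has_field_derivative_transform_within[OF DERIV_const[of 0] \<open>d > 0\<close> \<open>s \<in> I\<close>])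
      (simp add: h0 dist_commute)
  ultimately have "A * ((l/2 - \<tau>) * n s $ 3) + (real r - 2) * \<kappa> * \<tau> * (\<kappa> * n s $ 3) = 0"
    using vector_derivative_unique_within[OF neq_bot[OF \<open>s \<in> I\<close>]]
    by (auto simp: has_real_derivative_iff_has_vector_derivative)
  then have "(A * (l/2 - \<tau>) + (real r - 2) * \<kappa>^2 * \<tau>) * n s $ 3 = 0"
    by (simp add: algebra_simps power2_eq_square)
  then have "A * (l/2 - \<tau>) + (real r - 2) * \<kappa>^2 * \<tau> = 0"
    using n0 by simp
  \<comment> \<open>\<open>height r\<close> vanishes near \<open>s\<close>, so its derivative at \<open>s\<close> gives a second equation for \<open>\<kappa>\<close> and \<open>\<tau>\<close>.\<close>
  then have 1: "A * (l/2) = (\<kappa>^2 + \<tau>^2) * \<tau>"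
    unfolding A_def by (simp add: algebra_simps)
  have 2: "(\<kappa>^2 + \<tau>^2)^2 = l^2/4 * A"
    using eqs[OF \<open>s \<in> I\<close> \<open>s \<in> I\<close>] h0[OF \<open>s \<in> I\<close>] \<open>d > 0\<close> by (simp add: A_def)
  \<comment> \<open>Multiplying \<open>2\<close> by \<open>A\<close> produces the square of the
    left-hand side of \<open>1\<close>. This eliminates \<open>l\<close> without a case distinction
    on whether it vanishes.\<close>
  have "(\<kappa>^2 + \<tau>^2)^2 * A = (A * (l/2))^2"
    unfolding 2 by (simp add: power2_eq_square)
  also have "\<dots> = (\<kappa>^2 + \<tau>^2)^2 * \<tau>^2"
    unfolding 1 by (simp add: power_mult_distrib)
  finally have "A = \<tau>^2"
    using kappa_pos by (simp add: add_pos_nonneg less_imp_neq[symmetric])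
  moreover have "A > \<tau>^2"
    unfolding A_def using kappa_pos assms(2) by (simp add: add_pos_nonneg)
  ultimately show False by simp
qed

end

section \<open>The polynomial condition and its sufficiency\<close>

text \<open>The bracket is the N-component of the tension equation for T3 = cos \<alpha> and B3 =
  sin \<alpha>; this is where \<open>P4\<close> originates.\<close>

lemma poly_P4:
  fixes r :: nat
  assumes "\<kappa> = \<zeta> * sin \<alpha>" "\<tau> = \<zeta> * cos \<alpha> + l/2"
  defines "A \<equiv> \<kappa>^2 + \<tau>^2 + (real r - 2) * \<kappa>^2"
  shows "poly (P4 r m l \<alpha>) \<zeta> = 8 * ((\<kappa>^2 + \<tau>^2)^2 - l^2/4 * A
    - (4 * m - l^2) * (A * sin \<alpha> + (real r - 2) * \<kappa> * \<tau> * cos \<alpha>) * sin \<alpha>)"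
proof -
  obtain S C R where SCR: "sin \<alpha> = S" "cos \<alpha> = C" "real r = R" by blast
  define k where "k = l/2"
  have l: "l = 2 * k" by (simp add: k_def)
  have c2: "cos (2 * \<alpha>) = 1 - 2 * S^2" by (simp add: cos_double_sin SCR)
  \<comment> \<open>With \<open>S\<close> and \<open>C\<close> as independent variables the two
    sides differ by a multiple of \<open>C^2 + S^2 - 1\<close>, whose cofactor is given.\<close>
  have "poly (P4 r m l \<alpha>) \<zeta> - 8 * ((\<kappa>^2 + \<tau>^2)^2 - l^2/4 * A
      - (4 * m - l^2) * (A * sin \<alpha> + (real r - 2) * \<kappa> * \<tau> * cos \<alpha>) * sin \<alpha>)
    = (- 32 * C * k * \<zeta>^3 - 8 * C^2 * \<zeta>^4 + 32 * S^2 * (1 - R) * k^2 * \<zeta>^2 + 32 * S^2 * m * (R - 1) * \<zeta>^2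
        - 8 * S^2 * \<zeta>^4 - 40 * k^2 * \<zeta>^2 - 8 * \<zeta>^4) * (C^2 + S^2 - 1)"
    unfolding P4_def A_def assms(1,2) SCR c2 l
    by (simp add: algebra_simps power2_eq_square power3_eq_cube power4_eq_xxxx)
  then show ?thesis
    using sin_cos_squared_add2[of \<alpha>] by (simp add: SCR)
qed

lemma has_real_derivative_unique_within:
  assumes "at s within I \<noteq> bot" "(f has_real_derivative a) (at s within I)"
    "(f has_real_derivative b) (at s within I)"
  shows "a = b"
  using assms vector_derivative_unique_within
  by (auto simp: has_real_derivative_iff_has_vector_derivative)

lemma der_on_has_real_derivative:
  assumes "smooth_on_interval I (f :: real \<Rightarrow> real)" "s \<in> I"
  shows "(f has_real_derivative der_on I f s) (at s within I)"
  using smooth_on_interval_has_vector_derivative[OF assms]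
  by (simp add: has_real_derivative_iff_has_vector_derivative)

context bcv_helix
begin

text \<open>Differentiating the prescribed T and comparing with the Frenet equation determines
  \<kappa>; differentiating N3 = 0 then determines \<tau>.\<close>

lemma adapted_angles_imp:
  assumes adapted: "adapted_angles m l \<alpha> \<zeta> I \<gamma> N \<beta>" and pos: "sin \<alpha> > 0"
  shows "s \<in> I \<Longrightarrow> n s $ 3 = 0" "s \<in> I \<Longrightarrow> t s $ 3 = cos \<alpha>" "s \<in> I \<Longrightarrow> b s $ 3 = sin \<alpha>"
    and "\<kappa> = \<zeta> * sin \<alpha>" "\<tau> = \<zeta> * cos \<alpha> + l/2"
proof -
  have t: "t u = vector [sin \<alpha> * cos (\<beta> u), sin \<alpha> * sin (\<beta> u), cos \<alpha>]" if "u \<in> I" for u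
    using adapted that
      bcv_components_vector[OF bcv_F_neq_0[OF that], of l "vector [sin \<alpha> * cos (\<beta> u), sin \<alpha> * sin (\<beta> u), cos \<alpha>]"]
    by (simp add: adapted_angles_def bcv_vector_def t_def)
  have n: "n u = vector [- sin (\<beta> u), cos (\<beta> u), 0]" if "u \<in> I" for u
    using adapted that
      bcv_components_vector[OF bcv_F_neq_0[OF that], of l "vector [- sin (\<beta> u), cos (\<beta> u), 0]"]
    by (simp add: adapted_angles_def bcv_vector_def n_def)
  have b: "b u $ 3 = sin \<alpha>" if "u \<in> I" for u
  proof -
    have "b u $ 3 = sin \<alpha> * ((cos (\<beta> u))^2 + (sin (\<beta> u))^2)"
      unfolding b_nth[OF that] t[OF that] n[OF that] vector_3 by algebra
    then show ?thesis by simp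
  qed
  show "s \<in> I \<Longrightarrow> n s $ 3 = 0" "s \<in> I \<Longrightarrow> t s $ 3 = cos \<alpha>" "s \<in> I \<Longrightarrow> b s $ 3 = sin \<alpha>"
    using t n b by simp_all
  obtain u where u: "u \<in> I" using nontrivial by blast
  have smooth_\<beta>: "smooth_on_interval I \<beta>" using adapted by (simp add: adapted_angles_def)
  note d\<beta> = der_on_has_real_derivative[OF smooth_\<beta> u]
  define d where "d = der_on I \<beta> u"
  have "((\<lambda>s. t s $ 1) has_real_derivative - sin \<alpha> * sin (\<beta> u) * d) (at u within I)"
    by (rule has_field_derivative_transform_within[where d=1, OF _ _ u])
      (auto intro!: derivative_eq_intros d\<beta> simp: t d_def)
  from has_real_derivative_unique_within[OF neq_bot[OF u] this deriv_t(1)[OF u]]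
  have 1: "- sin \<alpha> * sin (\<beta> u) * d = - \<kappa> * sin (\<beta> u) + (phi u - l * cos \<alpha>) * (sin \<alpha> * sin (\<beta> u))"
    by (simp add: t[OF u] n[OF u])
  have "((\<lambda>s. t s $ 2) has_real_derivative sin \<alpha> * cos (\<beta> u) * d) (at u within I)"
    by (rule has_field_derivative_transform_within[where d=1, OF _ _ u])
      (auto intro!: derivative_eq_intros d\<beta> simp: t d_def)
  from has_real_derivative_unique_within[OF neq_bot[OF u] this deriv_t(2)[OF u]]
  have 2: "sin \<alpha> * cos (\<beta> u) * d = \<kappa> * cos (\<beta> u) - (phi u - l * cos \<alpha>) * (sin \<alpha> * cos (\<beta> u))"
    by (simp add: t[OF u] n[OF u])
  \<comment> \<open>\<open>E\<close> is the expression inside the absolute value that defines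
    \<zeta>. The factors \<open>sin (\<beta> u)\<close> and \<open>cos (\<beta> u)\<close> cannot
    both vanish, so \<kappa> = sin \<alpha> * E, and \<kappa> > 0 makes \<open>E\<close>
    positive.\<close>
  define E where "E = d + phi u - l * cos \<alpha>"
  have "(\<kappa> - sin \<alpha> * E) * sin (\<beta> u) = 0" "(\<kappa> - sin \<alpha> * E) * cos (\<beta> u) = 0"
    using 1 2 by (simp_all add: E_def algebra_simps)
  then have \<kappa>: "\<kappa> = sin \<alpha> * E"
    using sin_zero_abs_cos_one[of "\<beta> u"] by auto
  have "phi u = 2 * m * sin \<alpha> * (\<gamma> u $ 2 * cos (\<beta> u) - \<gamma> u $ 1 * sin (\<beta> u))"
    by (simp add: phi_def t[OF u] algebra_simps)
  then have "\<zeta> = \<bar>E\<bar>"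
    using adapted u by (simp add: adapted_angles_def E_def d_def)
  moreover have "E > 0" using \<kappa> kappa_pos pos by (simp add: zero_less_mult_iff)
  ultimately show \<kappa>\<zeta>: "\<kappa> = \<zeta> * sin \<alpha>" using \<kappa> by simp
  have "((\<lambda>s. n s $ 3) has_real_derivative 0) (at u within I)"
    by (rule has_field_derivative_transform_within[where d=1, OF DERIV_const _ u]) (auto simp: n)
  from has_real_derivative_unique_within[OF neq_bot[OF u] this deriv_n_3[OF u]]
  have "sin \<alpha> * (\<tau> - l/2 - \<zeta> * cos \<alpha>) = 0"
    by (simp add: t[OF u] b[OF u] \<kappa>\<zeta> algebra_simps)
  then show "\<tau> = \<zeta> * cos \<alpha> + l/2" using pos by simp
qed

lemma not_geodesic: "\<not> geodesic (bcv_metric m l) I \<gamma>"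
proof
  assume g: "geodesic (bcv_metric m l) I \<gamma>"
  obtain u where u: "u \<in> I" using nontrivial by blast
  have "N u = 0" using g u frenet(1)[OF u] kappa_pos by (simp add: geodesic_def)
  then show False
    using orthonormal(2)[OF u] linear_0[OF linear_components[OF u]] by (simp add: n_def)
qed

text \<open>N3 = 0 removes the B-component of the tension field, and the root condition removes the
  N-component.\<close>

lemma adapted_angles_proper_r_harmonic:
  assumes "adapted_angles m l \<alpha> \<zeta> I \<gamma> N \<beta>" "sin \<alpha> > 0" "r \<ge> 2" "poly (P4 r m l \<alpha>) \<zeta> = 0"
  shows "proper_r_harmonic (bcv_metric m l) r I \<gamma>"
proof -
  note ad = adapted_angles_imp[OF assms(1,2)]
  have "r_tension (bcv_metric m l) r I \<gamma> s = 0" if "s \<in> I" for s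
    unfolding r_tension_eq_0_iff[OF that assms(3)] height_def
    using assms(4) poly_P4[OF ad(4,5), of r m] by (simp add: ad(1-3)[OF that])
  then show ?thesis
    by (simp add: proper_r_harmonic_def r_harmonic_def not_geodesic)
qed

end

section \<open>Reversing the direction of a curve\<close>

lemma christoffel_minus_left: "christoffel g p (- u) v = - christoffel g p u v"
  by (simp add: christoffel_def vec_eq_iff sum_negf)

lemma der_on_reverse:
  assumes "at s within I \<noteq> bot" "at (- s) within uminus ` I \<noteq> bot"
    and "(f has_vector_derivative f') (at s within I)"
  shows "((\<lambda>u. f (- u)) has_vector_derivative - f') (at (- s) within uminus ` I)"
    and "der_on (uminus ` I) (\<lambda>u. f (- u)) (- s) = - der_on I f s"
proof -
  have "(uminus has_vector_derivative (- 1 :: real)) (at (- s) within uminus ` I)"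
    using has_vector_derivative_minus[OF has_vector_derivative_id, of "at (- s) within uminus ` I"]
    by (simp add: id_def)
  moreover have "(f has_vector_derivative f') (at (- (- s)) within uminus ` uminus ` I)"
    using assms(3) by (simp add: image_image)
  ultimately show 1: "((\<lambda>u. f (- u)) has_vector_derivative - f') (at (- s) within uminus ` I)"
    using vector_diff_chain_within[of uminus "-1" "- s" "uminus ` I" f f'] by (simp add: o_def)
  show "der_on (uminus ` I) (\<lambda>u. f (- u)) (- s) = - der_on I f s"
    using der_on_eqI[OF assms(2) 1] der_on_eqI[OF assms(1,3)] by simp
qed

lemma cov_deriv_reverse:
  assumes "at s within I \<noteq> bot" "at (- s) within uminus ` I \<noteq> bot"
    and "(\<gamma> has_vector_derivative \<gamma>') (at s within I)" "(V has_vector_derivative V') (at s within I)"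
  shows "cov_deriv g (uminus ` I) (\<lambda>u. \<gamma> (- u)) (\<lambda>u. V (- u)) (- s) = - cov_deriv g I \<gamma> V s"
  using der_on_reverse(2)[OF assms(1,2,3)] der_on_reverse(2)[OF assms(1,2,4)]
  by (simp add: cov_deriv_def christoffel_minus_left)

section \<open>Smoothness from families closed under differentiation\<close>

text \<open>By induction every iterated derivative agrees with a member of \<open>S\<close>.
  Agreement holds on \<open>I\<close> only, which is all that derivatives within \<open>I\<close>
  see.\<close>

lemma smooth_on_interval_closedI:
  assumes nb: "\<And>s. s \<in> I \<Longrightarrow> at s within I \<noteq> bot"
    and closed: "\<And>f. f \<in> S \<Longrightarrow> \<exists>f'\<in>S. \<forall>s\<in>I. (f has_vector_derivative f' s) (at s within I)"
    and "f \<in> S"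
  shows "smooth_on_interval I f"
proof -
  have ex: "\<exists>h\<in>S. \<forall>s\<in>I. (der_on I ^^ k) f s = h s" for k
  proof (induction k)
    case 0
    show ?case using \<open>f \<in> S\<close> by auto
  next
    case (Suc k)
    then obtain h where h: "h \<in> S" "\<And>s. s \<in> I \<Longrightarrow> (der_on I ^^ k) f s = h s" by blast
    obtain h' where h': "h' \<in> S" "\<And>s. s \<in> I \<Longrightarrow> (h has_vector_derivative h' s) (at s within I)"
      using closed[OF h(1)] by blast
    have "(der_on I ^^ Suc k) f s = h' s" if "s \<in> I" for s
      using der_on_cong[of I "(der_on I ^^ k) f" h s] h(2) der_on_eqI[OF nb h'(2), OF that that] that by simp
    then show ?case using h'(1) by blast
  qed
  have "(der_on I ^^ k) f differentiable at s within I" if s: "s \<in> I" for k s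
  proof -
    obtain h where h: "h \<in> S" "\<And>s. s \<in> I \<Longrightarrow> (der_on I ^^ k) f s = h s" using ex by blast
    then obtain h' where "(h has_vector_derivative h' s) (at s within I)"
      using closed[OF h(1)] s by blast
    then show ?thesis
      using has_vector_derivative_transform[where f = h and g = "(der_on I ^^ k) f", OF s h(2)]
        differentiableI_vector by blast
  qed
  then show ?thesis by (simp add: smooth_on_interval_def differentiable_on_def)
qed

lemma smooth_on_interval_bounded_linear:
  assumes nb: "\<And>s. s \<in> I \<Longrightarrow> at s within I \<noteq> bot"
    and "bounded_linear L" "smooth_on_interval I f"
  shows "smooth_on_interval I (\<lambda>s. L (f s))"
proof (rule smooth_on_interval_closedI[OF nb])
  let ?S = "{\<lambda>s. L (f s) |f. smooth_on_interval I f}"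
  show "(\<lambda>s. L (f s)) \<in> ?S" using assms(3) by blast
  show "\<exists>h'\<in>?S. \<forall>s\<in>I. (h has_vector_derivative h' s) (at s within I)" if "h \<in> ?S" for h
  proof -
    obtain f where f: "h = (\<lambda>s. L (f s))" "smooth_on_interval I f" using \<open>h \<in> ?S\<close> by blast
    then have "\<forall>s\<in>I. (h has_vector_derivative L (der_on I f s)) (at s within I)"
      using bounded_linear.has_vector_derivative[OF assms(2)] smooth_on_interval_has_vector_derivative by blast
    moreover have "(\<lambda>s. L (der_on I f s)) \<in> ?S" using smooth_on_interval_der_on[OF f(2)] by blast
    ultimately show ?thesis by (rule bexI)
  qed
qed

text \<open>A set of functions closed under differentiation consists of smooth functions; applied to the algebra
  generated by the smooth functions, this yields the smoothness of products without Leibniz's formula.\<close>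

inductive_set smooth_algebra :: "real set \<Rightarrow> (real \<Rightarrow> real) set" for I where
  smooth: "smooth_on_interval I f \<Longrightarrow> f \<in> smooth_algebra I"
| add: "f \<in> smooth_algebra I \<Longrightarrow> g \<in> smooth_algebra I \<Longrightarrow> (\<lambda>s. f s + g s) \<in> smooth_algebra I"
| mult: "f \<in> smooth_algebra I \<Longrightarrow> g \<in> smooth_algebra I \<Longrightarrow> (\<lambda>s. f s * g s) \<in> smooth_algebra I"

lemma smooth_on_interval_algebra:
  assumes nb: "\<And>s. s \<in> I \<Longrightarrow> at s within I \<noteq> bot" and f: "f \<in> smooth_algebra I"
  shows "smooth_on_interval I f"
proof (rule smooth_on_interval_closedI[OF nb _ f])
  show "\<exists>h'\<in>smooth_algebra I. \<forall>s\<in>I. (h has_vector_derivative h' s) (at s within I)" if "h \<in> smooth_algebra I" for h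
    using that
  proof induction
    case (smooth f)
    then show ?case
      using smooth_on_interval_der_on smooth_on_interval_has_vector_derivative smooth_algebra.smooth by blast
  next
    case (add f g)
    then obtain f' g' where "f' \<in> smooth_algebra I" "g' \<in> smooth_algebra I"
      "\<forall>s\<in>I. (f has_vector_derivative f' s) (at s within I)" "\<forall>s\<in>I. (g has_vector_derivative g' s) (at s within I)"
      by blast
    then show ?case
      by (intro bexI[of _ "\<lambda>s. f' s + g' s"] ballI has_vector_derivative_add smooth_algebra.add) auto
  next
    case (mult f g)
    then obtain f' g' where "f' \<in> smooth_algebra I" "g' \<in> smooth_algebra I"
      "\<forall>s\<in>I. (f has_vector_derivative f' s) (at s within I)" "\<forall>s\<in>I. (g has_vector_derivative g' s) (at s within I)"
      by blast
    with mult.hyps show ?case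
      by (intro bexI[of _ "\<lambda>s. f s * g' s + f' s * g s"] ballI has_vector_derivative_mult
          smooth_algebra.add smooth_algebra.mult) auto
  qed
qed

lemma smooth_on_interval_const:
  assumes nb: "\<And>s. s \<in> I \<Longrightarrow> at s within I \<noteq> bot"
  shows "smooth_on_interval I (\<lambda>_. c)"
proof (rule smooth_on_interval_closedI[OF nb])
  show "(\<lambda>_. c) \<in> range (\<lambda>c _. c)" by blast
  show "\<exists>h'\<in>range (\<lambda>c _. c). \<forall>s\<in>I. (h has_vector_derivative h' s) (at s within I)"
    if "h \<in> range (\<lambda>c _. c)" for h :: "real \<Rightarrow> 'a"
    using that by (intro bexI[of _ "\<lambda>_. 0"]) auto
qed

text \<open>Adjoining \<open>f\<close> to the smooth functions keeps the family closed under
  differentiation.\<close>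

lemma smooth_on_interval_antiderivative:
  assumes nb: "\<And>s. s \<in> I \<Longrightarrow> at s within I \<noteq> bot"
    and f: "\<And>s. s \<in> I \<Longrightarrow> (f has_vector_derivative f' s) (at s within I)" and "smooth_on_interval I f'"
  shows "smooth_on_interval I f"
proof (rule smooth_on_interval_closedI[OF nb, where S = "insert f {h. smooth_on_interval I h}"])
  show "\<exists>h'\<in>insert f {h. smooth_on_interval I h}. \<forall>s\<in>I. (h has_vector_derivative h' s) (at s within I)"
    if "h \<in> insert f {h. smooth_on_interval I h}" for h
  proof -
    have "\<exists>h'. smooth_on_interval I h' \<and> (\<forall>s\<in>I. (h has_vector_derivative h' s) (at s within I))"
      using that f assms(3) smooth_on_interval_der_on smooth_on_interval_has_vector_derivative by blast
    then show ?thesis by blast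
  qed
qed auto

lemma smooth_on_interval_reverse:
  assumes nb: "\<And>s. s \<in> I \<Longrightarrow> at s within I \<noteq> bot" "\<And>s. s \<in> I \<Longrightarrow> at (- s) within uminus ` I \<noteq> bot"
    and f: "smooth_on_interval I f"
  shows "smooth_on_interval (uminus ` I) (\<lambda>u. f (- u))"
proof (rule smooth_on_interval_closedI)
  let ?S = "{\<lambda>u. f (- u) |f. smooth_on_interval I f}"
  show "(\<lambda>u. f (- u)) \<in> ?S" using f by blast
  show "\<exists>h'\<in>?S. \<forall>s\<in>uminus ` I. (h has_vector_derivative h' s) (at s within uminus ` I)" if "h \<in> ?S" for h
  proof -
    obtain f where h: "h = (\<lambda>u. f (- u))" and f: "smooth_on_interval I f" using \<open>h \<in> ?S\<close> by blast
    have "(h has_vector_derivative - der_on I f s) (at (- s) within uminus ` I)" if s: "s \<in> I" for s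
      unfolding h by (rule der_on_reverse(1)[OF nb(1)[OF s] nb(2)[OF s]
            smooth_on_interval_has_vector_derivative[OF f s]])
    then have "\<forall>s\<in>uminus ` I. (h has_vector_derivative - der_on I f (- s)) (at s within uminus ` I)"
      by auto
    moreover have "smooth_on_interval I (\<lambda>s. - der_on I f s)"
      by (rule smooth_on_interval_bounded_linear[OF nb(1) _ smooth_on_interval_der_on[OF f]])
        (simp_all add: bounded_linear_minus bounded_linear_ident)
    then have "(\<lambda>u. - der_on I f (- u)) \<in> ?S"
      by (intro CollectI exI[of _ "\<lambda>s. - der_on I f s"]) simp
    ultimately show ?thesis by (rule bexI)
  qed
qed (use nb in auto)

text \<open>T changes sign, but its covariant derivative along the curve changes sign twice, so N
  and \<kappa> survive. B = T \<and> N changes sign, and the remaining Frenet equations then hold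
  with the same \<tau>.\<close>

lemma (in bcv_helix) reverse:
  defines "I' \<equiv> uminus ` I" and "\<gamma>' \<equiv> \<lambda>s. \<gamma> (- s)" and "N' \<equiv> \<lambda>s. N (- s)" and "B' \<equiv> \<lambda>s. - B (- s)"
  shows "bcv_helix m l I' \<gamma>' N' B' \<kappa> \<tau>"
    and "s \<in> I \<Longrightarrow> der_on I' \<gamma>' (- s) = - der_on I \<gamma> s"
proof -
  have I': "is_interval I'" "\<exists>a\<in>I'. \<exists>b\<in>I'. a < b"
    using interval nontrivial by (force simp: I'_def)+
  have nb': "at (- s) within I' \<noteq> bot" if "s \<in> I" for s
  proof -
    obtain a b where "a \<in> I'" "b \<in> I'" "a < b" using I'(2) by blast
    then show ?thesis using at_within_interval_neq_bot[OF I'(1)] that by (auto simp: I'_def)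
  qed
  note rev = smooth_on_interval_reverse[OF neq_bot nb'[unfolded I'_def], folded I'_def]
  note cov = cov_deriv_reverse[OF neq_bot nb'[unfolded I'_def] smooth_on_interval_has_vector_derivative[OF smooth(1)],
      folded I'_def, folded \<gamma>'_def]
  have minus: "cov_deriv g I \<gamma> (\<lambda>s. - V s) s = - cov_deriv g I \<gamma> V s"
    "((\<lambda>s. - V s) has_vector_derivative - V') (at s within I)"
    if "s \<in> I" "(V has_vector_derivative V') (at s within I)" for g V V' s
    using cov_deriv_linear[OF neq_bot[OF that(1)] that(2) that(2), of g \<gamma> "-1" 0] has_vector_derivative_minus[OF that(2)]
    by simp_all
  show T: "der_on I' \<gamma>' (- s) = - der_on I \<gamma> s" if "s \<in> I" for s
    using der_on_reverse(2)[OF neq_bot[OF that] nb'[OF that, unfolded I'_def]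
        smooth_on_interval_has_vector_derivative[OF smooth(1) that]]
    by (simp add: I'_def \<gamma>'_def)
  have smooth_B: "smooth_on_interval I (\<lambda>s. - B s)"
    by (rule smooth_on_interval_bounded_linear[OF neq_bot _ smooth(3)])
      (simp_all add: bounded_linear_minus bounded_linear_ident)
  have "cov_deriv (bcv_metric m l) I' \<gamma>' (der_on I' \<gamma>') (- s) = \<kappa> *\<^sub>R N' (- s)" if s: "s \<in> I" for s
  proof -
    note dT = smooth_on_interval_has_vector_derivative[OF smooth_on_interval_der_on[OF smooth(1)] s]
    have "cov_deriv (bcv_metric m l) I' \<gamma>' (der_on I' \<gamma>') (- s)
        = cov_deriv (bcv_metric m l) I' \<gamma>' (\<lambda>u. - der_on I \<gamma> (- u)) (- s)"
      using T s by (intro cov_deriv_cong) (auto simp: I'_def)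
    also have "\<dots> = \<kappa> *\<^sub>R N s"
      using cov[OF s s s minus(2)[OF s dT]] minus(1)[OF s dT] frenet(1)[OF s] by simp
    finally show ?thesis by (simp add: N'_def)
  qed
  moreover have "cov_deriv (bcv_metric m l) I' \<gamma>' N' (- s) = - \<kappa> *\<^sub>R der_on I' \<gamma>' (- s) + \<tau> *\<^sub>R B' (- s)"
    if s: "s \<in> I" for s
    using cov[OF s s s smooth_on_interval_has_vector_derivative[OF smooth(2) s]] frenet(2)[OF s] T[OF s]
    by (simp add: N'_def B'_def)
  moreover have "cov_deriv (bcv_metric m l) I' \<gamma>' B' (- s) = - \<tau> *\<^sub>R N' (- s)" if s: "s \<in> I" for s
  proof -
    note dB = smooth_on_interval_has_vector_derivative[OF smooth(3) s]
    show ?thesis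
      using cov[OF s s s minus(2)[OF s dB]] minus(1)[OF s dB] frenet(3)[OF s] by (simp add: N'_def B'_def)
  qed
  moreover have "bcv_metric m l (\<gamma>' (- s)) (der_on I' \<gamma>' (- s)) (der_on I' \<gamma>' (- s)) = 1
      \<and> bcv_metric m l (\<gamma>' (- s)) (N' (- s)) (N' (- s)) = 1
      \<and> bcv_metric m l (\<gamma>' (- s)) (der_on I' \<gamma>' (- s)) (N' (- s)) = 0
      \<and> B' (- s) = bcv_wedge m l (\<gamma>' (- s)) (der_on I' \<gamma>' (- s)) (N' (- s))" if s: "s \<in> I" for s
  proof -
    note F = bcv_F_neq_0[OF s]
    note lc = linear_components[OF s]
    have "bcv_components m l (\<gamma> s) (- B s) = bcv_components m l (\<gamma> s) (bcv_wedge m l (\<gamma> s) (- der_on I \<gamma> s) (N s))"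
      using orthonormal(4)[OF s]
      by (simp add: bcv_components_wedge[OF F] linear_neg[OF lc] cross_minus_left t_def n_def b_def)
    then have "- B s = bcv_wedge m l (\<gamma> s) (- der_on I \<gamma> s) (N s)"
      using bcv_vector_components[OF F] by metis
    then show ?thesis
      unfolding T[OF s] using orthonormal(1-3)[OF s]
      by (simp add: \<gamma>'_def N'_def B'_def bcv_metric_eq_inner[OF F] linear_neg[OF lc] t_def n_def)
  qed
  moreover have "\<gamma>' ` I' \<subseteq> bcv_space m" using sub by (auto simp: \<gamma>'_def I'_def)
  moreover have "smooth_on_interval I' \<gamma>'" "smooth_on_interval I' N'" "smooth_on_interval I' B'"
    using rev smooth(1,2) smooth_B by (auto simp: \<gamma>'_def N'_def B'_def)
  ultimately have "frenet_helix_frame m l I' \<gamma>' N' B' \<kappa> \<tau>"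
    using I' kappa_pos unfolding frenet_helix_frame_def arc_length_curve_def by (auto simp: I'_def)
  then show "bcv_helix m l I' \<gamma>' N' B' \<kappa> \<tau>" by (rule bcv_helix.intro)
qed

text \<open>An interval is contractible, so \<open>Complex (c s) (d s)\<close> has a continuous
  logarithm, whose imaginary part is the angle. Differentiability comes afterwards: near
  \<open>s\<close> the increment of \<beta> is below \<open>pi/2\<close>, hence equals the arcsine
  of the sine of the difference, which is polynomial in \<open>c\<close> and
  \<open>d\<close>.\<close>

lemma angle_function:
  fixes c d :: "real \<Rightarrow> real"
  assumes I: "is_interval I"
    and 1: "\<And>s. s \<in> I \<Longrightarrow> (c s)^2 + (d s)^2 = 1"
    and c: "\<And>s. s \<in> I \<Longrightarrow> (c has_real_derivative c' s) (at s within I)"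
    and d: "\<And>s. s \<in> I \<Longrightarrow> (d has_real_derivative d' s) (at s within I)"
  obtains \<beta> where "\<And>s. s \<in> I \<Longrightarrow> cos (\<beta> s) = c s" "\<And>s. s \<in> I \<Longrightarrow> sin (\<beta> s) = d s"
    "\<And>s. s \<in> I \<Longrightarrow> (\<beta> has_real_derivative c s * d' s - d s * c' s) (at s within I)"
proof -
  have "continuous_on I c" "continuous_on I d"
    using c d by (auto simp: continuous_on_eq_continuous_within intro: DERIV_continuous)
  then have cont: "continuous_on I (\<lambda>s. Complex (c s) (d s))"
    by (intro continuous_intros)
  have contr: "contractible I"
    using I by (intro convex_imp_contractible) (simp add: is_interval_convex)
  have nz: "Complex (c s) (d s) \<noteq> 0" if "s \<in> I" for s
    using 1[OF that] by (auto simp: complex_eq_iff)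
  obtain g where g: "continuous_on I g" "\<And>s. s \<in> I \<Longrightarrow> Complex (c s) (d s) = exp (g s)"
    using continuous_logarithm_on_contractible[OF cont contr nz] by blast
  define \<beta> where "\<beta> s = Im (g s)" for s
  have "exp (Re (g s)) = 1" if "s \<in> I" for s
    using arg_cong[OF g(2)[OF that], of norm] 1[OF that] by (simp add: complex_norm)
  then have cd: "cos (\<beta> s) = c s" "sin (\<beta> s) = d s" if "s \<in> I" for s
    using arg_cong[OF g(2)[OF that], of Re] arg_cong[OF g(2)[OF that], of Im] that
    by (simp_all add: Re_exp Im_exp \<beta>_def)
  have "(\<beta> has_real_derivative c s * d' s - d s * c' s) (at s within I)" if s: "s \<in> I" for s
  proof -
    have "continuous_on I \<beta>" unfolding \<beta>_def by (intro continuous_intros g)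
    then obtain \<delta> where "\<delta> > 0" and \<delta>: "\<And>u. u \<in> I \<Longrightarrow> dist u s < \<delta> \<Longrightarrow> dist (\<beta> u) (\<beta> s) < pi/2"
      using s pi_half_gt_zero unfolding continuous_on_iff by meson
    show ?thesis
    proof (rule has_field_derivative_transform_within[OF _ \<open>\<delta> > 0\<close> s])
      have "((\<lambda>u. d u * c s - c u * d s) has_real_derivative d' s * c s - c' s * d s) (at s within I)"
        by (intro DERIV_diff DERIV_cmult_right c d s)
      moreover have "(arcsin has_real_derivative 1) (at (d s * c s - c s * d s))"
        using DERIV_arcsin[of 0] by simp
      ultimately have "((\<lambda>u. arcsin (d u * c s - c u * d s)) has_real_derivative 1 * (d' s * c s - c' s * d s)) (at s within I)"
        by (rule DERIV_chain2[rotated])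
      from DERIV_add[OF DERIV_const[of "\<beta> s"] this]
      show "((\<lambda>u. \<beta> s + arcsin (d u * c s - c u * d s)) has_real_derivative c s * d' s - d s * c' s) (at s within I)"
        by (simp add: mult.commute)
      show "\<beta> s + arcsin (d u * c s - c u * d s) = \<beta> u" if "u \<in> I" "dist u s < \<delta>" for u
      proof -
        have "d u * c s - c u * d s = sin (\<beta> u - \<beta> s)"
          using cd that(1) s by (simp add: sin_diff)
        moreover have *: "\<bar>\<beta> u - \<beta> s\<bar> < pi/2" using \<delta>[OF that] by (simp only: dist_real_def)
        moreover have "arcsin (sin (\<beta> u - \<beta> s)) = \<beta> u - \<beta> s"
          by (rule arcsin_sin) (use * in linarith)+
        ultimately show ?thesis by simp
      qed
    qed
  qed
  then show thesis using that cd by blast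
qed

section \<open>Classification of the helices with horizontal normal\<close>

lemma has_real_derivative_zero_imp_const:
  fixes f :: "real \<Rightarrow> real"
  assumes "is_interval I" "\<And>s. s \<in> I \<Longrightarrow> (f has_real_derivative 0) (at s within I)"
  shows "\<exists>c. \<forall>s\<in>I. f s = c"
  using assms by (intro has_derivative_zero_constant)
    (auto simp: is_interval_convex has_field_derivative_def lambda_zero)

context bcv_helix
begin

lemma deriv_gamma:
  assumes "s \<in> I"
  shows "((\<lambda>s. \<gamma> s $ 1) has_real_derivative bcv_F m (\<gamma> s) * t s $ 1) (at s within I)"
    and "((\<lambda>s. \<gamma> s $ 2) has_real_derivative bcv_F m (\<gamma> s) * t s $ 2) (at s within I)"
    and "((\<lambda>s. \<gamma> s $ 3) has_real_derivative t s $ 3 + l/2 * (\<gamma> s $ 1 * t s $ 2 - \<gamma> s $ 2 * t s $ 1))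
      (at s within I)"
proof -
  have d: "((\<lambda>s. \<gamma> s $ i) has_real_derivative der_on I \<gamma> s $ i) (at s within I)" for i
    using has_vector_derivative_vec_nth[OF smooth_on_interval_has_vector_derivative[OF smooth(1) assms]]
    by (simp add: has_real_derivative_iff_has_vector_derivative)
  have "der_on I \<gamma> s = bcv_vector m l (\<gamma> s) (t s)"
    by (simp add: t_def bcv_F_neq_0 assms)
  then show "((\<lambda>s. \<gamma> s $ 1) has_real_derivative bcv_F m (\<gamma> s) * t s $ 1) (at s within I)"
    "((\<lambda>s. \<gamma> s $ 2) has_real_derivative bcv_F m (\<gamma> s) * t s $ 2) (at s within I)"
    "((\<lambda>s. \<gamma> s $ 3) has_real_derivative t s $ 3 + l/2 * (\<gamma> s $ 1 * t s $ 2 - \<gamma> s $ 2 * t s $ 1))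
      (at s within I)"
    using d[of 1] d[of 2] d[of 3] by (simp_all add: bcv_vector_nth)
qed

lemma der_on_eq_real_derivative:
  assumes "s \<in> I" "(f has_real_derivative f') (at s within I)"
  shows "der_on I f s = f'"
  using assms der_on_eqI[OF neq_bot] by (simp add: has_real_derivative_iff_has_vector_derivative)

text \<open>T3 and B3 have derivatives proportional to N3, hence are constant. The horizontal part
  of T is orthogonal to N and so is \<open>d\<close> times N rotated by a right angle.
  Differentiating N3 = 0 relates \<open>c\<close> and \<open>d\<close>; with \<open>d = 0\<close> it
  would force \<open>c = 0\<close>, against \<open>c^2 + d^2 = 1\<close>.\<close>

lemma horizontal_normal_constants:
  assumes n3: "\<And>s. s \<in> I \<Longrightarrow> n s $ 3 = 0"
  shows "\<exists>c d. c^2 + d^2 = 1 \<and> d \<noteq> 0 \<and> \<kappa> * c = (\<tau> - l/2) * d \<and>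
    (\<forall>s\<in>I. t s $ 3 = c \<and> b s $ 3 = d \<and> t s $ 1 = d * n s $ 2 \<and> t s $ 2 = - (d * n s $ 1)
      \<and> (n s $ 1)^2 + (n s $ 2)^2 = 1)"
proof -
  have "\<exists>c. \<forall>s\<in>I. t s $ 3 = c"
    by (rule has_real_derivative_zero_imp_const[OF interval])
      (use deriv_t(3) n3 in auto)
  then obtain c where c: "\<And>s. s \<in> I \<Longrightarrow> t s $ 3 = c" by blast
  have "\<exists>d. \<forall>s\<in>I. b s $ 3 = d"
    by (rule has_real_derivative_zero_imp_const[OF interval])
      (use deriv_b_3 n3 in auto)
  then obtain d where d: "\<And>s. s \<in> I \<Longrightarrow> b s $ 3 = d" by blast
  obtain u where u: "u \<in> I" using nontrivial by blast
  have n1: "(n s $ 1)^2 + (n s $ 2)^2 = 1" if "s \<in> I" for s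
    using orthonormal(2)[OF that] n3[OF that] by (simp add: inner_3 power2_eq_square)
  have tn: "t s $ 1 * n s $ 1 + t s $ 2 * n s $ 2 = 0" if "s \<in> I" for s
    using orthonormal(3)[OF that] n3[OF that] by (simp add: inner_3)
  have b3: "t s $ 1 * n s $ 2 - t s $ 2 * n s $ 1 = d" if "s \<in> I" for s
    using b_nth(3)[OF that] d[OF that] by simp
  have t1: "t s $ 1 = d * n s $ 2" if "s \<in> I" for s
    using n1[OF that] tn[OF that] b3[OF that] by algebra
  have t2: "t s $ 2 = - (d * n s $ 1)" if "s \<in> I" for s
    using n1[OF that] tn[OF that] b3[OF that] by algebra
  have "(t u $ 1)^2 + (t u $ 2)^2 + c^2 = 1"
    using orthonormal(1)[OF u] c[OF u] by (simp add: inner_3 power2_eq_square)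
  then have cd: "c^2 + d^2 = 1"
    unfolding t1[OF u] t2[OF u] using n1[OF u] by algebra
  have "((\<lambda>s. n s $ 3) has_real_derivative 0) (at u within I)"
    by (rule has_field_derivative_transform_within[where d=1, OF DERIV_const _ u]) (auto simp: n3)
  from has_real_derivative_unique_within[OF neq_bot[OF u] this deriv_n_3[OF u]]
  have \<kappa>c: "\<kappa> * c = (\<tau> - l/2) * d" by (simp add: c[OF u] d[OF u])
  have "d \<noteq> 0"
  proof
    assume "d = 0"
    then have "c = 0" using \<kappa>c kappa_pos by simp
    then show False using cd \<open>d = 0\<close> by simp
  qed
  with c d cd \<kappa>c t1 t2 n1 show ?thesis by blast
qed

lemma horizontal_normal_classification:
  assumes m: "m \<noteq> 0" and n3: "\<And>s. s \<in> I \<Longrightarrow> n s $ 3 = 0" and pos: "\<And>s. s \<in> I \<Longrightarrow> b s $ 3 > 0"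
  shows "\<exists>\<alpha> \<zeta>. 0 < \<alpha> \<and> \<alpha> < pi \<and> \<zeta> > 0 \<and> horizontal_normal_helix_of_type m l \<alpha> \<zeta> I \<gamma> \<and>
    \<kappa> = \<zeta> * sin \<alpha> \<and> \<tau> = \<zeta> * cos \<alpha> + l/2 \<and> (\<forall>s\<in>I. t s $ 3 = cos \<alpha> \<and> b s $ 3 = sin \<alpha>)"
proof -
  obtain c d where cd: "c^2 + d^2 = 1" and \<kappa>c: "\<kappa> * c = (\<tau> - l/2) * d"
    and const: "\<forall>s\<in>I. t s $ 3 = c \<and> b s $ 3 = d \<and> t s $ 1 = d * n s $ 2 \<and> t s $ 2 = - (d * n s $ 1)
      \<and> (n s $ 1)^2 + (n s $ 2)^2 = 1"
    using horizontal_normal_constants[OF n3] by blast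
  have c: "t s $ 3 = c" and d: "b s $ 3 = d"
    and t: "t s $ 1 = d * n s $ 2" "t s $ 2 = - (d * n s $ 1)"
    and n1: "(n s $ 1)^2 + (n s $ 2)^2 = 1" if "s \<in> I" for s
    using const that by auto
  obtain u where u: "u \<in> I" using nontrivial by blast
  have "d > 0" using pos[OF u] d[OF u] by simp
  have "c^2 < 1" using cd \<open>d > 0\<close> by (smt (verit) zero_less_power)
  then have "\<bar>c\<bar> < 1" by (simp add: abs_square_less_1)
  \<comment> \<open>As \<open>d > 0\<close>, the principal value of arccos has sine
    \<open>d\<close>; a negative \<open>d\<close> would need an angle outside (0, \<pi>).\<close>
  define \<alpha> where "\<alpha> = arccos c"
  have \<alpha>: "0 < \<alpha>" "\<alpha> < pi" "cos \<alpha> = c"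
    using \<open>\<bar>c\<bar> < 1\<close> arccos_lt_bounded[of c] by (auto simp: \<alpha>_def)
  have "sin \<alpha> = sqrt (1 - c^2)"
    using \<open>\<bar>c\<bar> < 1\<close> by (simp add: \<alpha>_def sin_arccos)
  also have "1 - c^2 = d^2" using cd by simp
  finally have sin: "sin \<alpha> = d" using \<open>d > 0\<close> by simp
  define \<zeta> where "\<zeta> = \<kappa> / d"
  have \<zeta>: "\<zeta> > 0" "\<kappa> = \<zeta> * d" using kappa_pos \<open>d > 0\<close> by (simp_all add: \<zeta>_def)
  have \<tau>: "\<tau> = \<zeta> * c + l/2" using \<kappa>c \<open>d > 0\<close> by (simp add: \<zeta>_def field_simps)
  \<comment> \<open>The value that \<beta>' must take: the definition of \<zeta> without absolute
    value, solved for \<beta>'.\<close>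
  define w where "w s = \<zeta> + l * c - phi s" for s
  have nt: "n s $ 1 = - (t s $ 2 / d)" "n s $ 2 = t s $ 1 / d" if "s \<in> I" for s
    using t[OF that] \<open>d > 0\<close> by simp_all
  have dt: "((\<lambda>s. t s $ 1) has_real_derivative - (t s $ 2 * w s)) (at s within I)"
    "((\<lambda>s. t s $ 2) has_real_derivative t s $ 1 * w s) (at s within I)" if "s \<in> I" for s
  proof -
    have "\<kappa> * n s $ 1 + (phi s - l * t s $ 3) * t s $ 2 = - (t s $ 2 * w s)"
      "\<kappa> * n s $ 2 - (phi s - l * t s $ 3) * t s $ 1 = t s $ 1 * w s"
      using \<open>d > 0\<close> by (simp_all add: nt[OF that] c[OF that] w_def \<zeta>_def field_simps)
    then show "((\<lambda>s. t s $ 1) has_real_derivative - (t s $ 2 * w s)) (at s within I)"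
      "((\<lambda>s. t s $ 2) has_real_derivative t s $ 1 * w s) (at s within I)"
      using deriv_t(1,2)[OF that] by simp_all
  qed
  have t12: "(t s $ 1)^2 + (t s $ 2)^2 = d^2" if "s \<in> I" for s
    using n1[OF that] t[OF that] by algebra
  obtain \<beta> where \<beta>: "\<And>s. s \<in> I \<Longrightarrow> cos (\<beta> s) = t s $ 1 / d" "\<And>s. s \<in> I \<Longrightarrow> sin (\<beta> s) = t s $ 2 / d"
    and "\<And>s. s \<in> I \<Longrightarrow> (\<beta> has_real_derivative t s $ 1 / d * (t s $ 1 * w s / d) - t s $ 2 / d * (- (t s $ 2 * w s) / d)) (at s within I)"
  proof (rule angle_function[OF interval, of "\<lambda>s. t s $ 1 / d" "\<lambda>s. t s $ 2 / d" "\<lambda>s. - (t s $ 2 * w s) / d" "\<lambda>s. t s $ 1 * w s / d"])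
    show "(t s $ 1 / d)^2 + (t s $ 2 / d)^2 = 1" if "s \<in> I" for s
      using t12[OF that] \<open>d > 0\<close> by (simp add: power_divide flip: add_divide_distrib)
  qed (use dt DERIV_cdivide in blast)+
  moreover have "t s $ 1 / d * (t s $ 1 * w s / d) - t s $ 2 / d * (- (t s $ 2 * w s) / d) = w s" if "s \<in> I" for s
  proof -
    have "t s $ 1 / d * (t s $ 1 * w s / d) - t s $ 2 / d * (- (t s $ 2 * w s) / d)
        = ((t s $ 1)^2 + (t s $ 2)^2) * w s / d^2"
      by (simp add: add_divide_distrib algebra_simps power2_eq_square)
    then show ?thesis using t12[OF that] \<open>d > 0\<close> by simp
  qed
  ultimately have d\<beta>: "(\<beta> has_real_derivative w s) (at s within I)" if "s \<in> I" for s
    using that by metis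
  have t\<beta>: "t s $ 1 = d * cos (\<beta> s)" "t s $ 2 = d * sin (\<beta> s)" if "s \<in> I" for s
    using \<beta>[OF that] \<open>d > 0\<close> by simp_all
  have n\<beta>: "n s $ 1 = - sin (\<beta> s)" "n s $ 2 = cos (\<beta> s)" if "s \<in> I" for s
    using nt[OF that] \<beta>[OF that] by simp_all
  have phi\<beta>: "phi s = 2 * m * d * (\<gamma> s $ 2 * cos (\<beta> s) - \<gamma> s $ 1 * sin (\<beta> s))" if "s \<in> I" for s
    by (simp add: phi_def t\<beta>[OF that] algebra_simps)
  let ?F = "\<lambda>s. bcv_F m (\<gamma> s)"
  \<comment> \<open>\<open>\<beta>' = w\<close> is a constant multiple of \<open>F\<close>: type I is the case of a nonzero constant \<open>1/\<mu>\<close>.\<close>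
  have "\<exists>k. \<forall>s\<in>I. w s / ?F s = k"
  proof (rule has_real_derivative_zero_imp_const[OF interval])
    show "((\<lambda>s. w s / ?F s) has_real_derivative 0) (at s within I)" if s: "s \<in> I" for s
    proof -
      \<comment> \<open>F and \<open>w\<close> solve the same linear equation f' = q f, so their
        quotient is constant.\<close>
      define q where "q = 2 * m * (\<gamma> s $ 1 * t s $ 1 + \<gamma> s $ 2 * t s $ 2)"
      have "(?F has_real_derivative ?F s * q) (at s within I)"
        unfolding bcv_F_def
        by (rule derivative_eq_intros deriv_gamma[OF s] refl)+
          (simp add: q_def bcv_F_def algebra_simps)
      moreover have "(w has_real_derivative w s * q) (at s within I)"
        unfolding w_def[abs_def] phi_def
        by (rule derivative_eq_intros deriv_gamma[OF s] dt[OF s] refl)+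
          (simp add: w_def phi_def q_def algebra_simps)
      ultimately have "((\<lambda>s. w s / ?F s) has_real_derivative (w s * q * ?F s - w s * (?F s * q)) / (?F s * ?F s)) (at s within I)"
        by (intro DERIV_divide bcv_F_neq_0 s)
      then show ?thesis by (simp add: mult_ac)
    qed
  qed
  then obtain k where k: "\<And>s. s \<in> I \<Longrightarrow> w s / ?F s = k" by blast
  have wF: "w s = k * ?F s" if "s \<in> I" for s
    using bcv_F_neq_0[OF that] k[OF that] by (simp add: field_simps)
  \<comment> \<open>Continuous lifting yields only a first derivative of \<beta>; smoothness follows
    since \<beta>' = k F is polynomial in the smooth coordinates.\<close>
  have smooth_\<beta>: "smooth_on_interval I \<beta>"
  proof -
    have const: "(\<lambda>_. a) \<in> smooth_algebra I" for a
      by (intro smooth_algebra.smooth smooth_on_interval_const neq_bot)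
    have coord: "(\<lambda>s. \<gamma> s $ i) \<in> smooth_algebra I" for i
      by (intro smooth_algebra.smooth smooth_on_interval_bounded_linear[OF _ bounded_linear_vec_nth] neq_bot smooth)
    have "(\<lambda>s. k * (1 + m * (\<gamma> s $ 1 * \<gamma> s $ 1 + \<gamma> s $ 2 * \<gamma> s $ 2))) \<in> smooth_algebra I"
      by (intro smooth_algebra.add smooth_algebra.mult const coord)
    then have smooth_deriv: "smooth_on_interval I (\<lambda>s. k * (1 + m * (\<gamma> s $ 1 * \<gamma> s $ 1 + \<gamma> s $ 2 * \<gamma> s $ 2)))"
      by (intro smooth_on_interval_algebra neq_bot)
    have deriv: "(\<beta> has_vector_derivative k * (1 + m * (\<gamma> s $ 1 * \<gamma> s $ 1 + \<gamma> s $ 2 * \<gamma> s $ 2))) (at s within I)"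
      if "s \<in> I" for s
      using d\<beta>[OF that] wF[OF that]
      by (simp add: has_real_derivative_iff_has_vector_derivative bcv_F_def power2_eq_square)
    show ?thesis
      by (rule smooth_on_interval_antiderivative[OF neq_bot deriv smooth_deriv])
  qed
  \<comment> \<open>Here z' = c - l phi / (4 m) with phi = \<zeta> + l c - \<beta>', which separates
    into a multiple of \<beta>' and the constant \<open>z_slope\<close>.\<close>
  have "\<exists>c3. \<forall>s\<in>I. \<gamma> s $ 3 - l / (4*m) * \<beta> s - z_slope m l \<alpha> \<zeta> * s = c3"
  proof (rule has_real_derivative_zero_imp_const[OF interval])
    show "((\<lambda>s. \<gamma> s $ 3 - l / (4*m) * \<beta> s - z_slope m l \<alpha> \<zeta> * s) has_real_derivative 0) (at s within I)"
      if s: "s \<in> I" for s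
      by (rule derivative_eq_intros deriv_gamma(3)[OF s] d\<beta>[OF s] refl)+
        (use m in \<open>simp add: z_slope_def w_def phi_def \<alpha> c[OF s] field_simps power2_eq_square\<close>)
  qed
  then obtain c3 where c3: "\<And>s. s \<in> I \<Longrightarrow> \<gamma> s $ 3 - l / (4*m) * \<beta> s - z_slope m l \<alpha> \<zeta> * s = c3" by blast
  have z: "\<gamma> s $ 3 = l / (4*m) * \<beta> s + z_slope m l \<alpha> \<zeta> * s + c3" if "s \<in> I" for s
    using c3[OF that] by (simp add: algebra_simps)
  have der_\<beta>: "der_on I \<beta> s = w s" if "s \<in> I" for s
    using der_on_eq_real_derivative[OF that d\<beta>[OF that]] .
  have adapted: "adapted_angles m l \<alpha> \<zeta> I \<gamma> N \<beta>"
  proof -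
    have "der_on I \<gamma> s = (sin \<alpha> * cos (\<beta> s)) *\<^sub>R bcv_E1 m l (\<gamma> s)
          + (sin \<alpha> * sin (\<beta> s)) *\<^sub>R bcv_E2 m l (\<gamma> s) + cos \<alpha> *\<^sub>R bcv_E3 (\<gamma> s)"
      "N s = - sin (\<beta> s) *\<^sub>R bcv_E1 m l (\<gamma> s) + cos (\<beta> s) *\<^sub>R bcv_E2 m l (\<gamma> s)" if "s \<in> I" for s
      using bcv_vector_components[OF bcv_F_neq_0[OF that], of l "der_on I \<gamma> s"]
        bcv_vector_components[OF bcv_F_neq_0[OF that], of l "N s"]
      by (simp_all add: bcv_vector_def t\<beta>[OF that] n\<beta>[OF that] n3[OF that] c[OF that] \<alpha> sin flip: t_def n_def)
    moreover have "\<zeta> = \<bar>der_on I \<beta> s + 2 * m * sin \<alpha> * (\<gamma> s $ 2 * cos (\<beta> s) - \<gamma> s $ 1 * sin (\<beta> s)) - l * cos \<alpha>\<bar>"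
      if "s \<in> I" for s
      using \<zeta>(1) by (simp add: der_\<beta>[OF that] w_def phi\<beta>[OF that] sin \<alpha>)
    ultimately show ?thesis by (simp add: adapted_angles_def smooth_\<beta>)
  qed
  have "helix_type_I m l \<alpha> \<zeta> I \<gamma> \<beta> \<or> helix_type_II m l \<alpha> \<zeta> I \<gamma> \<beta> \<or> helix_type_III m l \<alpha> \<zeta> I \<gamma> \<beta>"
  proof (cases "k = 0")
    case False
    define \<mu> where "\<mu> = 1 / k"
    have \<mu>: "\<mu> \<noteq> 0" "\<mu> * k = 1" using False by (simp_all add: \<mu>_def)
    have F\<mu>: "?F s = \<mu> * w s" if "s \<in> I" for s using wF[OF that] False by (simp add: \<mu>_def)
    \<comment> \<open>Since F = \<mu> \<beta>', the equation x' = F T1 reads x' = \<mu> d \<beta>'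
      cos \<beta> and integrates explicitly; y is analogous.\<close>
    have "\<exists>c1. \<forall>s\<in>I. \<gamma> s $ 1 - \<mu> * d * sin (\<beta> s) = c1"
    proof (rule has_real_derivative_zero_imp_const[OF interval])
      show "((\<lambda>s. \<gamma> s $ 1 - \<mu> * d * sin (\<beta> s)) has_real_derivative 0) (at s within I)" if s: "s \<in> I" for s
        by (rule derivative_eq_intros deriv_gamma[OF s] d\<beta>[OF s] refl)+ (simp add: F\<mu>[OF s] t\<beta>[OF s])
    qed
    then obtain c1 where c1: "\<And>s. s \<in> I \<Longrightarrow> \<gamma> s $ 1 - \<mu> * d * sin (\<beta> s) = c1" by blast
    have x: "\<gamma> s $ 1 = \<mu> * d * sin (\<beta> s) + c1" if "s \<in> I" for s using c1[OF that] by (simp add: algebra_simps)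
    have "\<exists>c2. \<forall>s\<in>I. \<gamma> s $ 2 + \<mu> * d * cos (\<beta> s) = c2"
    proof (rule has_real_derivative_zero_imp_const[OF interval])
      show "((\<lambda>s. \<gamma> s $ 2 + \<mu> * d * cos (\<beta> s)) has_real_derivative 0) (at s within I)" if s: "s \<in> I" for s
        by (rule derivative_eq_intros deriv_gamma[OF s] d\<beta>[OF s] refl)+ (simp add: F\<mu>[OF s] t\<beta>[OF s])
    qed
    then obtain c2 where c2: "\<And>s. s \<in> I \<Longrightarrow> \<gamma> s $ 2 + \<mu> * d * cos (\<beta> s) = c2" by blast
    have y: "\<gamma> s $ 2 = - (\<mu> * d * cos (\<beta> s)) + c2" if "s \<in> I" for s using c2[OF that] by (simp add: algebra_simps)
    have w: "w s = 2 * m * d * (c1 * sin (\<beta> s) - c2 * cos (\<beta> s)) + 2 * m * \<mu> * d^2 + \<zeta> + l * c" if "s \<in> I" for s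
    proof -
      have "w s = 2 * m * d * (c1 * sin (\<beta> s) - c2 * cos (\<beta> s))
          + 2 * m * \<mu> * d^2 * ((sin (\<beta> s))^2 + (cos (\<beta> s))^2) + \<zeta> + l * c"
        unfolding w_def phi\<beta>[OF that] x[OF that] y[OF that] by algebra
      then show ?thesis by simp
    qed
    \<comment> \<open>This is F = \<mu> \<beta>' at a single point: after inserting the formulas for
      x and y, all terms containing \<beta> cancel.\<close>
    have "m * (c1^2 + c2^2) = \<mu> * (l * c + \<zeta>) - 1 + m * \<mu>^2 * d^2"
      using F\<mu>[OF u] sin_cos_squared_add[of "\<beta> u"] unfolding bcv_F_def x[OF u] y[OF u] w[OF u] by algebra
    then have "c1^2 + c2^2 = (\<mu> * (l * c + \<zeta>) - 1 + m * \<mu>^2 * d^2) / m"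
      using m by (simp add: eq_divide_eq mult.commute)
    also have "\<dots> = \<mu>/m * ((l * c + \<zeta> - 1/\<mu>) + m * \<mu> * d^2)"
      using m \<mu>(1) by (simp add: field_simps power2_eq_square)
    finally have "c1^2 + c2^2 = \<mu>/m * ((l * c + \<zeta> - 1/\<mu>) + m * \<mu> * d^2)" .
    moreover have "\<not> (\<exists>\<beta>\<^sub>o. \<forall>s\<in>I. \<beta> s = \<beta>\<^sub>o)"
    proof
      assume "\<exists>\<beta>\<^sub>o. \<forall>s\<in>I. \<beta> s = \<beta>\<^sub>o"
      then obtain \<beta>\<^sub>o where "\<And>s. s \<in> I \<Longrightarrow> \<beta> s = \<beta>\<^sub>o" by blast
      then have "(\<beta> has_real_derivative 0) (at u within I)"
        by (intro has_field_derivative_transform_within[where d=1, OF DERIV_const _ u]) auto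
      from has_real_derivative_unique_within[OF neq_bot[OF u] this d\<beta>[OF u]]
      show False using wF[OF u] False bcv_F_neq_0[OF u] by simp
    qed
    ultimately have "helix_type_I m l \<alpha> \<zeta> I \<gamma> \<beta>"
      unfolding helix_type_I_def
      using \<mu>(1) x y z w der_\<beta>
      by (intro exI[of _ \<mu>] exI[of _ c1] exI[of _ c2] exI[of _ c3]) (simp add: \<alpha> sin)
    then show ?thesis by blast
  next
    case True
    then have w0: "w s = 0" if "s \<in> I" for s using wF[OF that] by simp
    have "\<exists>\<beta>\<^sub>o. \<forall>s\<in>I. \<beta> s = \<beta>\<^sub>o"
      by (rule has_real_derivative_zero_imp_const[OF interval])
        (use d\<beta> w0 in auto)
    then obtain \<beta>\<^sub>o where \<beta>o: "\<And>s. s \<in> I \<Longrightarrow> \<beta> s = \<beta>\<^sub>o" by blast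
    \<comment> \<open>With \<beta>' = 0 the projection to the base lies on a straight line with
      direction (cos \<beta>o, sin \<beta>o). Type III is the case of a line parallel to a
      coordinate axis, type II every other line.\<close>
    have eq: "2 * m * d * (\<gamma> s $ 2 * cos \<beta>\<^sub>o - \<gamma> s $ 1 * sin \<beta>\<^sub>o) = \<zeta> + l * c" if "s \<in> I" for s
      using w0[OF that] phi\<beta>[OF that] \<beta>o[OF that] by (simp add: w_def)
    have z': "\<gamma> s $ 3 = z_slope m l \<alpha> \<zeta> * s + (l / (4*m) * \<beta>\<^sub>o + c3)" if "s \<in> I" for s
      using z[OF that] \<beta>o[OF that] by simp
    have dx: "der_on I (\<lambda>t. \<gamma> t $ 1) s = ?F s * (d * cos \<beta>\<^sub>o)"
      "der_on I (\<lambda>t. \<gamma> t $ 2) s = ?F s * (d * sin \<beta>\<^sub>o)" if "s \<in> I" for s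
      using der_on_eq_real_derivative[OF that deriv_gamma(1)[OF that]]
        der_on_eq_real_derivative[OF that deriv_gamma(2)[OF that]]
      by (simp_all add: t\<beta>[OF that] \<beta>o[OF that])
    show ?thesis
    proof (cases "sin \<beta>\<^sub>o * cos \<beta>\<^sub>o = 0")
      case False
      define c1 where "c1 = (\<zeta> + l * cos \<alpha>) / (2 * m * sin \<alpha> * cos \<beta>\<^sub>o)"
      have y: "\<gamma> s $ 2 = \<gamma> s $ 1 * tan \<beta>\<^sub>o + c1" if "s \<in> I" for s
        using eq[OF that] False m \<open>d > 0\<close> by (simp add: c1_def \<alpha> sin tan_def field_simps)
      have "helix_type_II m l \<alpha> \<zeta> I \<gamma> \<beta>"
        unfolding helix_type_II_def
        using False \<beta>o y z' dx
        by (intro exI[of _ \<beta>\<^sub>o] exI[of _ c1] exI[of _ "l / (4*m) * \<beta>\<^sub>o + c3"])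
          (auto simp: c1_def bcv_F_def sin mult_ac)
      then show ?thesis by blast
    next
      case True
      \<comment> \<open>Signed Euclidean distance of that line from the origin.\<close>
      define e where "e = (\<zeta> + l * cos \<alpha>) / (2 * m * sin \<alpha>)"
      have e: "2 * m * d * e = \<zeta> + l * c" using m \<open>d > 0\<close> by (simp add: e_def \<alpha> sin)
      have sc: "(sin \<beta>\<^sub>o)^2 + (cos \<beta>\<^sub>o)^2 = 1" by simp
      consider "cos \<beta>\<^sub>o = 0" | "sin \<beta>\<^sub>o = 0" using True by auto
      then have "cos \<beta>\<^sub>o = 0 \<and> (\<forall>s\<in>I. \<gamma> s $ 1 = - sin \<beta>\<^sub>o * e \<and>
            (der_on I (\<lambda>t. \<gamma> t $ 2) s)^2 = (1 + m * ((- sin \<beta>\<^sub>o * e)^2 + (\<gamma> s $ 2)^2))^2 * (sin \<alpha>)^2)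
          \<or> sin \<beta>\<^sub>o = 0 \<and> (\<forall>s\<in>I. \<gamma> s $ 2 = cos \<beta>\<^sub>o * e \<and>
            (der_on I (\<lambda>t. \<gamma> t $ 1) s)^2 = (1 + m * ((\<gamma> s $ 1)^2 + (cos \<beta>\<^sub>o * e)^2))^2 * (sin \<alpha>)^2)"
      proof cases
        case 1
        have x: "\<gamma> s $ 1 = - sin \<beta>\<^sub>o * e" if "s \<in> I" for s
        proof -
          have "2 * m * d * (\<gamma> s $ 1 + sin \<beta>\<^sub>o * e) = 0"
            using eq[OF that] e sc 1 by algebra
          then show ?thesis using m \<open>d > 0\<close> by simp
        qed
        have "(der_on I (\<lambda>t. \<gamma> t $ 2) s)^2 = (1 + m * ((- sin \<beta>\<^sub>o * e)^2 + (\<gamma> s $ 2)^2))^2 * (sin \<alpha>)^2"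
          if "s \<in> I" for s
          unfolding x[OF that, symmetric] dx(2)[OF that] sin
          using sc 1 by (simp add: bcv_F_def power_mult_distrib)
        then show ?thesis using 1 x by blast
      next
        case 2
        have y: "\<gamma> s $ 2 = cos \<beta>\<^sub>o * e" if "s \<in> I" for s
        proof -
          have "2 * m * d * (\<gamma> s $ 2 - cos \<beta>\<^sub>o * e) = 0"
            using eq[OF that] e sc 2 by algebra
          then show ?thesis using m \<open>d > 0\<close> by simp
        qed
        have "(der_on I (\<lambda>t. \<gamma> t $ 1) s)^2 = (1 + m * ((\<gamma> s $ 1)^2 + (cos \<beta>\<^sub>o * e)^2))^2 * (sin \<alpha>)^2"
          if "s \<in> I" for s
          unfolding y[OF that, symmetric] dx(1)[OF that] sin
          using sc 2 by (simp add: bcv_F_def power_mult_distrib)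
        then show ?thesis using 2 y by blast
      qed
      then have "helix_type_III m l \<alpha> \<zeta> I \<gamma> \<beta>"
        unfolding helix_type_III_def e_def[symmetric] using True \<beta>o z' by blast
      then show ?thesis by blast
    qed
  qed
  moreover have "bcv_metric m l (\<gamma> s) (N s) (bcv_E3 (\<gamma> s)) = 0" if "s \<in> I" for s
    using n3[OF that] by (simp add: n_def bcv_components_def)
  ultimately have "horizontal_normal_helix_of_type m l \<alpha> \<zeta> I \<gamma>"
    unfolding horizontal_normal_helix_of_type_def using frame adapted by blast
  then show ?thesis
    using \<zeta> \<tau> c d \<alpha> sin by (intro exI[of _ \<alpha>] exI[of _ \<zeta>]) simp
qed

end

theorem theorem4p6:
  fixes r :: nat and m l :: real
  assumes "r \<ge> 2" and "4 * m \<noteq> l^2" and "m \<noteq> 0"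
  shows "(\<forall>\<alpha> \<zeta>. 0 < \<alpha> \<and> \<alpha> < pi \<and> \<zeta> > 0 \<and> poly (P4 r m l \<alpha>) \<zeta> = 0 \<longrightarrow>
            (\<forall>I \<gamma>. horizontal_normal_helix_of_type m l \<alpha> \<zeta> I \<gamma> \<longrightarrow>
              proper_r_harmonic (bcv_metric m l) r I \<gamma>))
       \<and> (\<forall>I \<gamma>. frenet_helix3 m l I \<gamma> \<and> proper_r_harmonic (bcv_metric m l) r I \<gamma> \<longrightarrow>
            (\<exists>\<alpha> \<zeta>. 0 < \<alpha> \<and> \<alpha> < pi \<and> \<zeta> > 0 \<and> poly (P4 r m l \<alpha>) \<zeta> = 0 \<and>
              (horizontal_normal_helix_of_type m l \<alpha> \<zeta> I \<gamma> \<or>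
               horizontal_normal_helix_of_type m l \<alpha> \<zeta> (uminus ` I) (\<lambda>s. \<gamma> (- s)))))"
proof (intro conjI allI impI; elim conjE)
  fix \<alpha> \<zeta> I \<gamma>
  assume \<alpha>: "0 < \<alpha>" "\<alpha> < pi" "poly (P4 r m l \<alpha>) \<zeta> = 0"
    and "horizontal_normal_helix_of_type m l \<alpha> \<zeta> I \<gamma>"
  then obtain N B \<kappa> \<tau> \<beta> where "frenet_helix_frame m l I \<gamma> N B \<kappa> \<tau>" and ad: "adapted_angles m l \<alpha> \<zeta> I \<gamma> N \<beta>"
    by (auto simp: horizontal_normal_helix_of_type_def)
  then interpret bcv_helix m l I \<gamma> N B \<kappa> \<tau> by (intro bcv_helix.intro)
  show "proper_r_harmonic (bcv_metric m l) r I \<gamma>"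
    using adapted_angles_proper_r_harmonic[OF ad sin_gt_zero[OF \<alpha>(1,2)] assms(1) \<alpha>(3)] .
next
  fix I \<gamma>
  assume "frenet_helix3 m l I \<gamma>" and "proper_r_harmonic (bcv_metric m l) r I \<gamma>"
  then obtain N B \<kappa> \<tau> where frame: "frenet_helix_frame m l I \<gamma> N B \<kappa> \<tau>" and harm: "r_harmonic (bcv_metric m l) r I \<gamma>"
    by (auto simp: frenet_helix3_def proper_r_harmonic_def)
  interpret bcv_helix m l I \<gamma> N B \<kappa> \<tau> using frame by (rule bcv_helix.intro)
  note n3 = r_harmonic_imp_n_3_eq_0[OF assms(2,1) harm]
  obtain u where u: "u \<in> I" using nontrivial by blast
  obtain d where d: "\<forall>s\<in>I. b s $ 3 = d" "d \<noteq> 0"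
    using horizontal_normal_constants[OF n3] by blast
  \<comment> \<open>Negating T3 and B3 together negates \<open>height r\<close>, so its product with
    B3 is unchanged. The root condition can therefore be read off the original curve in either
    orientation.\<close>
  have root: "poly (P4 r m l \<alpha>) \<zeta> = 0"
    if "\<kappa> = \<zeta> * sin \<alpha>" "\<tau> = \<zeta> * cos \<alpha> + l/2"
      "t u $ 3 = cos \<alpha> \<and> b u $ 3 = sin \<alpha> \<or> t u $ 3 = - cos \<alpha> \<and> b u $ 3 = - sin \<alpha>" for \<alpha> \<zeta>
    using r_tension_eq_0_iff[OF u assms(1)] harm u that(3) unfolding poly_P4[OF that(1,2)]
    by (auto simp: r_harmonic_def height_def algebra_simps)
  show "\<exists>\<alpha> \<zeta>. 0 < \<alpha> \<and> \<alpha> < pi \<and> \<zeta> > 0 \<and> poly (P4 r m l \<alpha>) \<zeta> = 0 \<and>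
              (horizontal_normal_helix_of_type m l \<alpha> \<zeta> I \<gamma> \<or>
               horizontal_normal_helix_of_type m l \<alpha> \<zeta> (uminus ` I) (\<lambda>s. \<gamma> (- s)))"
  proof (cases "d > 0")
    case True
    then have "b s $ 3 > 0" if "s \<in> I" for s using d that by simp
    then obtain \<alpha> \<zeta> where "0 < \<alpha>" "\<alpha> < pi" "\<zeta> > 0" "horizontal_normal_helix_of_type m l \<alpha> \<zeta> I \<gamma>"
      "\<kappa> = \<zeta> * sin \<alpha>" "\<tau> = \<zeta> * cos \<alpha> + l/2"
      "\<forall>s\<in>I. t s $ 3 = cos \<alpha> \<and> b s $ 3 = sin \<alpha>"
      using horizontal_normal_classification[OF assms(3) n3] by blast
    then show ?thesis using root u by blast
  next
    case False
    \<comment> \<open>Here B3 < 0, so the classification is applied to the reversed curve, whose B3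
      is positive.\<close>
    interpret rev: bcv_helix m l "uminus ` I" "\<lambda>s. \<gamma> (- s)" "\<lambda>s. N (- s)" "\<lambda>s. - B (- s)" \<kappa> \<tau>
      by (rule reverse)
    have rev: "rev.t (- s) = - t s" "rev.n (- s) = n s" "rev.b (- s) = - b s" if "s \<in> I" for s
      using reverse(2)[OF that] linear_neg[OF linear_components[OF that]]
      by (simp_all add: rev.t_def rev.n_def rev.b_def t_def n_def b_def)
    have "rev.n s $ 3 = 0" "rev.b s $ 3 > 0" if "s \<in> uminus ` I" for s
      using that rev n3 d False by auto
    then obtain \<alpha> \<zeta> where \<alpha>: "0 < \<alpha>" "\<alpha> < pi" "\<zeta> > 0"
      "horizontal_normal_helix_of_type m l \<alpha> \<zeta> (uminus ` I) (\<lambda>s. \<gamma> (- s))"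
      "\<kappa> = \<zeta> * sin \<alpha>" "\<tau> = \<zeta> * cos \<alpha> + l/2"
      "\<forall>s\<in>uminus ` I. rev.t s $ 3 = cos \<alpha> \<and> rev.b s $ 3 = sin \<alpha>"
      using rev.horizontal_normal_classification[OF assms(3)] by blast
    have "t u $ 3 = - cos \<alpha>" "b u $ 3 = - sin \<alpha>"
      using \<alpha>(7) rev[OF u] u by auto
    then show ?thesis using root[OF \<alpha>(5,6)] \<alpha>(1-4) by blast
  qed
qed

end
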